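(* Let $0<c<\infty$ and let $r_1:\mathbb R^+\to\mathbb R^+$ be increasing with $r_1(n)/\sqrt n\to0$ as $n\to\infty$. Let $\varphi(n)=\exp(c\sqrt n+r_1(n))$ and $$S(\varphi):=\left\{x\in\mathbb I:\lim_{n\to\infty}\frac{S_n(x)}{\varphi(n)}=1\right\}.$$ Then $\dim_{\rm H}S(\varphi)=\frac12$.
   Context: $\mathbb R^+$ is the set of positive reals and $\mathbb I:=[0,1)\setminus\mathbb Q$. For $x\in\mathbb I$, $a_1(x),a_2(x),\dots$ are the coefficients (partial quotients, positive integers) of its continued fraction expansion $x=[a_1(x),a_2(x),\dots]=1/(a_1(x)+1/(a_2(x)+\cdots))$, and $S_n(x):=\sum_{k=1}^n a_k(x)$. $\dim_{\rm H}$ denotes Hausdorff dimension. *)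

theory Defs
  imports "HOL-Analysis.Analysis"
begin

section \<open>Hausdorff measure and Hausdorff dimension\<close>

text \<open>
  The power $|U|^s$ of the diameter of a covering set. The case distinction realises the usual
  conventions at \<open>s = 0\<close> (a nonempty set, even a singleton, counts 1; the empty set counts 0),
  whereas \<open>0 powr 0 = 0\<close> in HOL.
\<close>

definition diam_powr :: "real \<Rightarrow> 'a::metric_space set \<Rightarrow> real" where
  "diam_powr s U = (if U = {} then 0 else if s = 0 then 1 else diameter U powr s)"

text \<open>
  Finite covers are included, since covering sets may be empty. The condition \<open>bounded\<close> is
  needed because \<open>diameter\<close> is a real number and has no meaningful value on unbounded sets.
\<close>

definition delta_covers :: "real \<Rightarrow> 'a::metric_space set \<Rightarrow> (nat \<Rightarrow> 'a set) set" where
  "delta_covers \<delta> E =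
     {U. E \<subseteq> (\<Union>i. U i) \<and> (\<forall>i. bounded (U i) \<and> diameter (U i) \<le> \<delta>)}"

definition hausdorff_premeasure :: "real \<Rightarrow> real \<Rightarrow> 'a::metric_space set \<Rightarrow> ennreal" where
  "hausdorff_premeasure s \<delta> E = (INF U\<in>delta_covers \<delta> E. \<Sum>i. ennreal (diam_powr s (U i)))"

definition hausdorff_measure :: "real \<Rightarrow> 'a::metric_space set \<Rightarrow> ennreal" where
  "hausdorff_measure s E = (SUP \<delta>\<in>{0<..}. hausdorff_premeasure s \<delta> E)"

text \<open>The infimum over the empty set is \<open>\<infinity>\<close>.\<close>

definition hausdorff_dim :: "'a::metric_space set \<Rightarrow> ereal" where
  "hausdorff_dim E = (INF s\<in>{s. 0 \<le> s \<and> hausdorff_measure s E = 0}. ereal s)"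


section \<open>Continued fraction expansions\<close>

definition unit_irrationals :: "real set" where
  "unit_irrationals = {0..<1} - \<rat>"

definition gauss_map :: "real \<Rightarrow> real" where
  "gauss_map x = frac (1 / x)"

text \<open>
  The partial quotients are indexed from 1; the value at index 0 is junk. That they are the
  coefficients of the continued fraction expansion of an irrational \<open>x\<close> in the unit interval
  is the theorem \<open>is_cf_expansion_iff\<close> below.
\<close>

definition cf_coeff :: "nat \<Rightarrow> real \<Rightarrow> nat" where
  "cf_coeff n x = nat \<lfloor>1 / (gauss_map ^^ (n - 1)) x\<rfloor>"

definition cf_sum :: "nat \<Rightarrow> real \<Rightarrow> nat" where
  "cf_sum n x = (\<Sum>k=1..n. cf_coeff k x)"

definition cf_sum_set :: "(real \<Rightarrow> real) \<Rightarrow> real set" where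
  "cf_sum_set \<phi> =
     {x \<in> unit_irrationals. (\<lambda>n. real (cf_sum n x) / \<phi> (real n)) \<longlonglongrightarrow> 1}"

text \<open>The finite continued fraction $[a_1,\dots,a_n] = 1/(a_1 + 1/(a_2 + \cdots + 1/a_n))$.\<close>

primrec cf_convergent :: "nat \<Rightarrow> (nat \<Rightarrow> nat) \<Rightarrow> real" where
  "cf_convergent 0 a = 0"
| "cf_convergent (Suc n) a = 1 / (real (a 1) + cf_convergent n (\<lambda>k. a (Suc k)))"

definition is_cf_expansion :: "(nat \<Rightarrow> nat) \<Rightarrow> real \<Rightarrow> bool" where
  "is_cf_expansion a x \<longleftrightarrow> (\<forall>k\<ge>1. a k \<ge> 1) \<and> (\<lambda>n. cf_convergent n a) \<longlonglongrightarrow> x"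

lemma cf_convergent_cong:
  "(\<And>k. k \<ge> 1 \<Longrightarrow> a k = b k) \<Longrightarrow> cf_convergent n a = cf_convergent n b"
proof (induction n arbitrary: a b)
  case (Suc n)
  have "cf_convergent n (\<lambda>k. a (Suc k)) = cf_convergent n (\<lambda>k. b (Suc k))"
    by (rule Suc.IH) (use Suc.prems in simp)
  then show ?case using Suc.prems[of 1] by simp
qed simp

lemma cf_convergent_bounds:
  "(\<And>k. k \<ge> 1 \<Longrightarrow> a k \<ge> 1) \<Longrightarrow> 0 \<le> cf_convergent n a \<and> cf_convergent n a \<le> 1"
proof (induction n arbitrary: a)
  case (Suc n)
  have "0 \<le> cf_convergent n (\<lambda>k. a (Suc k))"
    using Suc.IH[of "\<lambda>k. a (Suc k)"] Suc.prems by simp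
  moreover have "real (a 1) \<ge> 1" using Suc.prems[of 1] by simp
  ultimately show ?case by (simp add: divide_le_eq)
qed simp

lemma unit_irrationals_gt_0: "x \<in> unit_irrationals \<Longrightarrow> 0 < x \<and> x < 1"
  unfolding unit_irrationals_def by (cases "x = 0") auto

lemma inverse_Rats_iff: "1 / x \<in> \<rat> \<longleftrightarrow> (x::real) \<in> \<rat>"
proof
  assume "1 / x \<in> \<rat>"
  then have "1 / (1 / x) \<in> \<rat>" by (rule Rats_divide[OF Rats_1])
  then show "x \<in> \<rat>" by simp
qed (intro Rats_divide, auto)

lemma gauss_map_in:
  assumes "x \<in> unit_irrationals"
  shows "gauss_map x \<in> unit_irrationals"
proof -
  have irr: "1 / x \<notin> \<rat>" using assms by (simp add: unit_irrationals_def inverse_Rats_iff)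
  have "gauss_map x \<notin> \<rat>"
  proof
    assume "gauss_map x \<in> \<rat>"
    then have "gauss_map x + of_int \<lfloor>1 / x\<rfloor> \<in> \<rat>" by (intro Rats_add) auto
    then show False using irr by (simp add: gauss_map_def frac_def)
  qed
  then show ?thesis by (simp add: unit_irrationals_def gauss_map_def frac_ge_0 frac_lt_1)
qed

lemma cf_coeff_Suc: "n \<ge> 1 \<Longrightarrow> cf_coeff (Suc n) x = cf_coeff n (gauss_map x)"
  by (cases n) (simp_all add: cf_coeff_def funpow_swap1)

lemma cf_coeff_1:
  assumes "x \<in> unit_irrationals"
  shows "cf_coeff 1 x \<ge> 1" "real (cf_coeff 1 x) + gauss_map x = 1 / x"
proof -
  have "1 \<le> 1 / x" using unit_irrationals_gt_0[OF assms] by (simp add: le_divide_eq)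
  then have *: "\<lfloor>1 / x\<rfloor> \<ge> 1" by simp
  show "cf_coeff 1 x \<ge> 1" unfolding cf_coeff_def using * by (simp del: one_le_floor)
  have "real (cf_coeff 1 x) = of_int \<lfloor>1 / x\<rfloor>"
    unfolding cf_coeff_def using * by (simp del: one_le_floor add: of_nat_nat)
  then show "real (cf_coeff 1 x) + gauss_map x = 1 / x" by (simp add: gauss_map_def frac_def)
qed

lemma cf_coeff_ge_1:
  "x \<in> unit_irrationals \<Longrightarrow> k \<ge> 1 \<Longrightarrow> cf_coeff k x \<ge> 1"
proof (induction k arbitrary: x)
  case (Suc k)
  show ?case
  proof (cases "k = 0")
    case True then show ?thesis using cf_coeff_1(1)[OF Suc.prems(1)] by simp
  next
    case False
    then show ?thesis using Suc.IH[OF gauss_map_in[OF Suc.prems(1)]] by (simp add: cf_coeff_Suc)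
  qed
qed simp

lemma cf_convergent_coeff_Suc:
  "cf_convergent (Suc n) (\<lambda>k. cf_coeff k x) =
     1 / (real (cf_coeff 1 x) + cf_convergent n (\<lambda>k. cf_coeff k (gauss_map x)))"
  using cf_convergent_cong[of "\<lambda>k. cf_coeff (Suc k) x" "\<lambda>k. cf_coeff k (gauss_map x)" n]
  by (simp add: cf_coeff_Suc)

lemma cf_two_step_contraction:
  fixes a b y z :: real
  assumes "a \<ge> 1" "b \<ge> 1" "y \<ge> 0" "z \<ge> 0"
  shows "\<bar>1 / (a + 1 / (b + y)) - 1 / (a + 1 / (b + z))\<bar> \<le> \<bar>y - z\<bar> / 4"
proof -
  define P where "P = a * (b + y) + 1"
  define Q where "Q = a * (b + z) + 1"
  have "1 * 1 \<le> a * (b + y)" "1 * 1 \<le> a * (b + z)" using assms by (intro mult_mono; simp)+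
  then have PQ: "P \<ge> 2" "Q \<ge> 2" by (simp_all add: P_def Q_def)
  have e1: "1 / (a + 1 / (b + y)) = (b + y) / P"
    using assms PQ by (simp add: P_def field_simps)
  have e2: "1 / (a + 1 / (b + z)) = (b + z) / Q"
    using assms PQ by (simp add: Q_def field_simps)
  have "(b + y) / P - (b + z) / Q = ((b + y) * Q - (b + z) * P) / (P * Q)"
    using PQ by (simp add: field_simps)
  also have "(b + y) * Q - (b + z) * P = y - z" by (simp add: P_def Q_def algebra_simps)
  finally have "\<bar>1 / (a + 1 / (b + y)) - 1 / (a + 1 / (b + z))\<bar> = \<bar>y - z\<bar> / (P * Q)"
    using e1 e2 PQ by (simp add: abs_mult)
  also have "\<dots> \<le> \<bar>y - z\<bar> / 4"
  proof (rule divide_left_mono)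
    show "4 \<le> P * Q" using mult_mono[of 2 P 2 Q] PQ by simp
  qed (use PQ in auto)
  finally show ?thesis .
qed

lemma cf_convergent_error:
  "x \<in> unit_irrationals \<Longrightarrow> \<bar>cf_convergent n (\<lambda>k. cf_coeff k x) - x\<bar> \<le> 2 * (1 / 2) ^ n"
proof (induction n arbitrary: x rule: induct_nat_012)
  case 0
  then show ?case using unit_irrationals_gt_0[of x] by simp
next
  case 1
  have "0 \<le> cf_convergent (Suc 0) (\<lambda>k. cf_coeff k x) \<and> cf_convergent (Suc 0) (\<lambda>k. cf_coeff k x) \<le> 1"
    by (rule cf_convergent_bounds) (use 1 cf_coeff_ge_1 in auto)
  then have "\<bar>cf_convergent (Suc 0) (\<lambda>k. cf_coeff k x) - x\<bar> \<le> 1"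
    using unit_irrationals_gt_0[OF 1] by linarith
  then show ?case by simp
next
  case (ge2 n)
  define y where "y = gauss_map x"
  define z where "z = gauss_map y"
  have y: "y \<in> unit_irrationals" and z: "z \<in> unit_irrationals"
    using ge2.prems gauss_map_in by (auto simp: y_def z_def)
  define C where "C = cf_convergent n (\<lambda>k. cf_coeff k z)"
  have C: "C \<ge> 0"
    unfolding C_def by (rule cf_convergent_bounds[THEN conjunct1]) (use z cf_coeff_ge_1 in auto)
  have x_eq: "x = 1 / (real (cf_coeff 1 x) + y)"
    using cf_coeff_1(2)[OF ge2.prems] by (simp add: y_def)
  have y_eq: "y = 1 / (real (cf_coeff 1 y) + z)"
    using cf_coeff_1(2)[OF y] by (simp add: z_def)
  have conv: "cf_convergent (Suc (Suc n)) (\<lambda>k. cf_coeff k x) =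
      1 / (real (cf_coeff 1 x) + 1 / (real (cf_coeff 1 y) + C))"
    by (simp only: cf_convergent_coeff_Suc C_def y_def z_def)
  have x_eq2: "x = 1 / (real (cf_coeff 1 x) + 1 / (real (cf_coeff 1 y) + z))"
    using x_eq y_eq by simp
  have ab: "real (cf_coeff 1 x) \<ge> 1" "real (cf_coeff 1 y) \<ge> 1"
    using cf_coeff_1(1)[OF ge2.prems] cf_coeff_1(1)[OF y] by linarith+
  have zpos: "z \<ge> 0" using unit_irrationals_gt_0[OF z] by simp
  have "\<bar>1 / (real (cf_coeff 1 x) + 1 / (real (cf_coeff 1 y) + C)) -
      1 / (real (cf_coeff 1 x) + 1 / (real (cf_coeff 1 y) + z))\<bar> \<le> \<bar>C - z\<bar> / 4"
    using cf_two_step_contraction[OF ab C zpos] .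
  then have "\<bar>cf_convergent (Suc (Suc n)) (\<lambda>k. cf_coeff k x) - x\<bar> \<le> \<bar>C - z\<bar> / 4"
    unfolding conv x_eq2[symmetric] .
  also have "\<dots> \<le> 2 * (1 / 2) ^ n / 4"
    using ge2.IH(1)[OF z] by (simp add: C_def)
  finally show ?case by simp
qed

lemma is_cf_expansion_cf_coeff:
  assumes "x \<in> unit_irrationals"
  shows "is_cf_expansion (\<lambda>k. cf_coeff k x) x"
proof -
  have "(\<lambda>n. cf_convergent n (\<lambda>k. cf_coeff k x) - x) \<longlonglongrightarrow> 0"
  proof (rule Lim_null_comparison)
    show "(\<lambda>n. 2 * (1 / 2 :: real) ^ n) \<longlonglongrightarrow> 0"
      by (intro tendsto_mult_right_zero LIMSEQ_power_zero) simp
  qed (use cf_convergent_error[OF assms] in simp)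
  then show ?thesis
    using cf_coeff_ge_1[OF assms] by (simp add: is_cf_expansion_def LIM_zero_iff)
qed

lemma is_cf_expansion_shift:
  assumes x: "x \<in> unit_irrationals" and a: "is_cf_expansion a x"
  shows "a 1 = cf_coeff 1 x" "is_cf_expansion (\<lambda>k. a (Suc k)) (gauss_map x)"
proof -
  let ?a' = "\<lambda>k. a (Suc k)"
  define y where "y = 1 / x - real (a 1)"
  have x0: "x \<noteq> 0" using unit_irrationals_gt_0[OF x] by simp
  have a1: "\<And>k. k \<ge> 1 \<Longrightarrow> a k \<ge> 1" using a by (simp add: is_cf_expansion_def)
  have "(\<lambda>n. cf_convergent (Suc n) a) \<longlonglongrightarrow> x"
    using a unfolding is_cf_expansion_def by (intro LIMSEQ_Suc) blast
  then have "(\<lambda>n. 1 / cf_convergent (Suc n) a - real (a 1)) \<longlonglongrightarrow> y"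
    unfolding y_def using x0 by (intro tendsto_intros)
  then have lim: "(\<lambda>n. cf_convergent n ?a') \<longlonglongrightarrow> y" by simp
  have bd: "0 \<le> cf_convergent n ?a' \<and> cf_convergent n ?a' \<le> 1" for n
    by (rule cf_convergent_bounds) (use a1 in simp)
  have "0 \<le> y" by (rule LIMSEQ_le_const[OF lim]) (use bd in auto)
  moreover have "y \<le> 1" by (rule LIMSEQ_le_const2[OF lim]) (use bd in auto)
  moreover have "y \<noteq> 1"
  proof
    assume "y = 1"
    then have "1 / x = real (a 1) + 1" by (simp add: y_def)
    then have "1 / x \<in> \<rat>" by simp
    then show False using x by (simp add: inverse_Rats_iff unit_irrationals_def)
  qed
  ultimately have fl: "\<lfloor>1 / x\<rfloor> = int (a 1)" by (intro floor_unique) (auto simp: y_def)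
  then show "a 1 = cf_coeff 1 x" by (simp add: cf_coeff_def)
  have "y = gauss_map x" using fl by (simp add: y_def gauss_map_def frac_def)
  then show "is_cf_expansion ?a' (gauss_map x)"
    using lim a1 by (simp add: is_cf_expansion_def)
qed

lemma is_cf_expansion_unique:
  "x \<in> unit_irrationals \<Longrightarrow> is_cf_expansion a x \<Longrightarrow> k \<ge> 1 \<Longrightarrow> a k = cf_coeff k x"
proof (induction k arbitrary: a x)
  case (Suc k)
  note sh = is_cf_expansion_shift[OF Suc.prems(1,2)]
  show ?case
  proof (cases "k = 0")
    case True then show ?thesis using sh(1) by simp
  next
    case False
    then show ?thesis
      using Suc.IH[OF gauss_map_in[OF Suc.prems(1)] sh(2)] by (simp add: cf_coeff_Suc)
  qed
qed simp

theorem is_cf_expansion_iff: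
  assumes "x \<in> unit_irrationals"
  shows "is_cf_expansion a x \<longleftrightarrow> (\<forall>k\<ge>1. a k = cf_coeff k x)"
proof
  assume r: "\<forall>k\<ge>1. a k = cf_coeff k x"
  then have "cf_convergent n a = cf_convergent n (\<lambda>k. cf_coeff k x)" for n
    by (intro cf_convergent_cong) simp
  then show "is_cf_expansion a x"
    using is_cf_expansion_cf_coeff[OF assms] r by (simp add: is_cf_expansion_def)
qed (use is_cf_expansion_unique[OF assms] in blast)

end

theory Submission
  imports Defs "HOL-Real_Asymp.Real_Asymp"
begin

text \<open>
  Both bounds rest on the size of cylinders: fixing the first \<open>n\<close> partial quotients
  \<open>a\<^sub>1, \<dots>, a\<^sub>n\<close> confines \<open>x\<close> to an interval whose length is, up to a factor exponential in
  \<open>n\<close>, the product of the \<open>1 / a\<^sub>j\<^sup>2\<close>.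

  Upper bound. Between the times \<open>k\<^sup>2 / M\<^sup>2\<close> and \<open>(k + 1)\<^sup>2 / M\<^sup>2\<close> the
  exponent \<open>c \<surd>n\<close> grows by about \<open>c / M\<close>, so \<open>\<phi>\<close> grows at least by a fixed factor
  greater than 1 (the monotone \<open>r\<^sub>1\<close> can only help). If \<open>S\<^sub>n \<sim> \<phi>(n)\<close>, then this block
  of about \<open>2 k / M\<^sup>2\<close> digits has a sum comparable with \<open>\<phi>\<close>, hence contains a digit of size
  at least \<open>exp (c k / M)\<close>, up to polynomial factors. In the covering sum with
  exponent \<open>s = 1 / 2 + d\<close> a free digit costs a factor at most \<open>Z = \<Sum> a\<^bsup>-(1 + d)\<^esup>\<close>, whereas a digit
  \<open>\<ge> T\<close> costs at most \<open>Z T\<^bsup>-d\<^esup>\<close>. A block therefore costs about \<open>exp (2 k ln Z / M\<^sup>2 - d c k / M)\<close>,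
  which tends to 0 once \<open>M > 2 ln Z / (d c)\<close>. This is where \<open>\<surd>n\<close> is critical: the number of
  digits in a block and the logarithm of the large digit are both linear in \<open>k\<close>, and cutting the
  blocks finer makes the second dominate. The covering sum is handled recursively, one digit at a
  time, by \<open>hausdorff_premeasure_digit_block\<close>; the outcome is \<open>hausdorff_measure_cf_sum_set_eq_0\<close>.

  Lower bound. Let the digit \<open>a\<^sub>n\<close> range freely over a window of \<open>\<phi>(n)\<^bsup>\<theta>\<^esup>\<close> integers that starts
  near the increment \<open>\<phi>(n) - \<phi>(n - 1)\<close>, with \<open>\<theta> < 1\<close>. As \<open>n \<phi>(n)\<^bsup>\<theta>\<^esup> = o(\<phi>(n))\<close>, all these points
  satisfy \<open>S\<^sub>n \<sim> \<phi>(n)\<close>. A mixed radix expansion of \<open>t \<in> [0, 1)\<close> selects the digits, and the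
  resulting map from \<open>[0, 1)\<close> into the set satisfies \<open>\<bar>t - u\<bar> \<le> C \<bar>g t - g u\<bar>\<^bsup>s\<^esup>\<close> as soon as
  \<open>2 s < \<theta>\<close>: every digit gains a factor \<open>\<phi>(n)\<^bsup>\<theta> - 2 s\<^esup> \<rightarrow> \<infinity>\<close>, which beats the loss caused by the
  first digit at which two points differ, since \<open>\<phi>\<close> grows at most exponentially. Pulling covers
  back to \<open>[0, 1)\<close> turns them into covers of a set of Lebesgue measure 1
  (\<open>hausdorff_measure_nonzero_if_inverse_hoelder\<close>), whence the \<open>s\<close>-dimensional measure is positive; see
  \<open>hausdorff_measure_cf_sum_set_neq_0\<close>.
\<close>

section \<open>Hausdorff premeasures and dimension\<close>

lemma hausdorff_premeasure_mono:
  "E \<subseteq> F \<Longrightarrow> hausdorff_premeasure s \<delta> E \<le> hausdorff_premeasure s \<delta> F"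
  unfolding hausdorff_premeasure_def delta_covers_def
  by (intro INF_superset_mono) auto

lemma hausdorff_premeasure_le_cover:
  assumes "U \<in> delta_covers \<delta> E"
  shows "hausdorff_premeasure s \<delta> E \<le> (\<Sum>i. ennreal (diam_powr s (U i)))"
  unfolding hausdorff_premeasure_def using assms by (rule INF_lower)

lemma diam_powr_nonneg [simp]: "0 \<le> diam_powr s U"
  by (simp add: diam_powr_def)

lemma hausdorff_premeasure_countable_subadditive:
  "hausdorff_premeasure s \<delta> (\<Union>n::nat. E n) \<le> (\<Sum>n. hausdorff_premeasure s \<delta> (E n))"
proof (rule ennreal_le_epsilon)
  fix e :: real
  assume fin: "(\<Sum>n. hausdorff_premeasure s \<delta> (E n)) < top" and e: "0 < e"
  have "\<exists>U \<in> delta_covers \<delta> (E n). (\<Sum>i. ennreal (diam_powr s (U i)))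
          \<le> hausdorff_premeasure s \<delta> (E n) + ennreal (e * (1 / 2) ^ Suc n)" for n
  proof -
    have "hausdorff_premeasure s \<delta> (E n) \<noteq> top"
      using fin ennreal_suminf_lessD[of "\<lambda>n. hausdorff_premeasure s \<delta> (E n)" top n] by auto
    then have "hausdorff_premeasure s \<delta> (E n)
        < hausdorff_premeasure s \<delta> (E n) + ennreal (e * (1 / 2) ^ Suc n)"
      using e ennreal_add_left_cancel_less[of "hausdorff_premeasure s \<delta> (E n)" 0 "ennreal (e * (1 / 2) ^ Suc n)"]
      by (simp add: top.not_eq_extremum)
    then show ?thesis
      unfolding hausdorff_premeasure_def INF_less_iff by (auto intro: less_imp_le)
  qed
  then obtain U where U: "\<And>n. U n \<in> delta_covers \<delta> (E n)"
    and sumU: "\<And>n. (\<Sum>i. ennreal (diam_powr s (U n i)))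
          \<le> hausdorff_premeasure s \<delta> (E n) + ennreal (e * (1 / 2) ^ Suc n)"
    by metis
  define V where "V i = (case prod_decode i of (n, j) \<Rightarrow> U n j)" for i
  have "V \<in> delta_covers \<delta> (\<Union>n. E n)"
  proof -
    have "x \<in> (\<Union>i. V i)" if "x \<in> E n" for x n
    proof -
      have "E n \<subseteq> (\<Union>j. U n j)" using U[of n] by (simp add: delta_covers_def)
      then obtain j where "x \<in> U n j" using \<open>x \<in> E n\<close> by blast
      then have "x \<in> V (prod_encode (n, j))" by (simp add: V_def)
      then show ?thesis by blast
    qed
    then show ?thesis
      using U by (auto simp: delta_covers_def V_def split: prod.split)
  qed
  then have "hausdorff_premeasure s \<delta> (\<Union>n. E n) \<le> (\<Sum>i. ennreal (diam_powr s (V i)))"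
    by (rule hausdorff_premeasure_le_cover)
  also have "\<dots> = (\<Sum>i. (\<lambda>(n, j). ennreal (diam_powr s (U n j))) (prod_decode i))"
    by (simp add: V_def case_prod_beta)
  also have "\<dots> = (\<Sum>n. \<Sum>j. ennreal (diam_powr s (U n j)))"
    by (rule suminf_ennreal_2dimen) simp
  also have "\<dots> \<le> (\<Sum>n. hausdorff_premeasure s \<delta> (E n) + ennreal (e * (1 / 2) ^ Suc n))"
    by (intro suminf_le sumU) auto
  also have "\<dots> = (\<Sum>n. hausdorff_premeasure s \<delta> (E n)) + (\<Sum>n. ennreal (e * (1 / 2) ^ Suc n))"
    by (rule suminf_add[symmetric]) auto
  also have "(\<Sum>n. ennreal (e * (1 / 2) ^ Suc n)) = ennreal e"
    by (rule suminf_ennreal_eq) (use e sums_mult[OF power_half_series, of e] in auto)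
  finally show "hausdorff_premeasure s \<delta> (\<Union>n. E n)
      \<le> (\<Sum>n. hausdorff_premeasure s \<delta> (E n)) + ennreal e" .
qed

lemma hausdorff_premeasure_empty: "0 \<le> \<delta> \<Longrightarrow> hausdorff_premeasure s \<delta> {} = 0"
  using hausdorff_premeasure_le_cover[of "\<lambda>_. {}" \<delta> "{}" s]
  by (auto simp: delta_covers_def diam_powr_def)

lemma hausdorff_premeasure_finite_subadditive:
  assumes "finite J" "0 \<le> \<delta>"
  shows "hausdorff_premeasure s \<delta> (\<Union>j\<in>J. E j) \<le> (\<Sum>j\<in>J. hausdorff_premeasure s \<delta> (E (j :: nat)))"
proof -
  define F where "F j = (if j \<in> J then E j else {})" for j
  have "(\<Union>j\<in>J. E j) = (\<Union>j. F j)" by (auto simp: F_def split: if_splits)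
  moreover have "(\<Sum>j. hausdorff_premeasure s \<delta> (F j)) = (\<Sum>j\<in>J. hausdorff_premeasure s \<delta> (F j))"
    by (rule suminf_finite) (use assms in \<open>auto simp: F_def hausdorff_premeasure_empty\<close>)
  ultimately show ?thesis
    using hausdorff_premeasure_countable_subadditive[of s \<delta> F] by (simp add: F_def)
qed

text \<open>
  The contraction pushes each cover of \<open>F\<close> forward to a cover of \<open>E\<close>. The bound \<open>L \<le> 1\<close> keeps the new
  cover subordinate to the same \<open>\<delta>\<close>. The set \<open>D\<close> is there because branches of the continued fraction
  map are contractions only on part of the line, while covering sets are arbitrary.
\<close>

lemma hausdorff_premeasure_lipschitz_image:
  fixes g :: "'a::metric_space \<Rightarrow> 'b::metric_space"
  assumes s: "0 < s" and L: "0 < L" "L \<le> 1"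
    and cov: "E \<subseteq> g ` (F \<inter> D)"
    and lip: "\<And>y z. y \<in> D \<Longrightarrow> z \<in> D \<Longrightarrow> dist (g y) (g z) \<le> L * dist y z"
  shows "hausdorff_premeasure s \<delta> E \<le> ennreal (L powr s) * hausdorff_premeasure s \<delta> F"
proof -
  have key: "ennreal (L powr - s) * hausdorff_premeasure s \<delta> E \<le> (\<Sum>i. ennreal (diam_powr s (U i)))"
    if U: "U \<in> delta_covers \<delta> F" for U
  proof -
    define V where "V i = g ` (U i \<inter> D)" for i
    have bd: "bounded (U i)" and dm: "diameter (U i) \<le> \<delta>" for i
      using U by (auto simp: delta_covers_def)
    have close: "dist (g y) (g z) \<le> L * diameter (U i)" if "y \<in> U i \<inter> D" "z \<in> U i \<inter> D" for y z i
    proof -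
      have "dist (g y) (g z) \<le> L * dist y z" using lip that by blast
      also have "\<dots> \<le> L * diameter (U i)"
        using diameter_bounded_bound[OF bd] that L by (intro mult_left_mono) auto
      finally show ?thesis .
    qed
    have d0: "0 \<le> diameter (U i)" for i by (rule diameter_ge_0[OF bd])
    have bV: "bounded (V i)" for i
    proof (cases "U i \<inter> D = {}")
      case False
      then obtain y where "y \<in> U i \<inter> D" by blast
      then show ?thesis
        unfolding V_def bounded_def using close by (intro exI[of _ "g y"] exI[of _ "L * diameter (U i)"]) auto
    qed (simp add: V_def)
    have dV: "diameter (V i) \<le> L * diameter (U i)" for i
    proof (cases "V i = {}")
      case False
      then show ?thesis
        unfolding diameter_def[of "V i"] using close by (auto simp: V_def intro!: cSUP_least)
    qed (use d0 L in simp)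
    have "V \<in> delta_covers \<delta> E"
    proof -
      have "L * diameter (U i) \<le> \<delta>" for i
        using mult_right_mono[OF L(2) d0, of i] dm[of i] by simp
      then have "diameter (V i) \<le> \<delta>" for i using dV[of i] order_trans by blast
      moreover have "E \<subseteq> (\<Union>i. V i)"
        using cov U by (fastforce simp: delta_covers_def V_def)
      ultimately show ?thesis using bV by (simp add: delta_covers_def)
    qed
    then have "hausdorff_premeasure s \<delta> E \<le> (\<Sum>i. ennreal (diam_powr s (V i)))"
      by (rule hausdorff_premeasure_le_cover)
    also have "\<dots> \<le> (\<Sum>i. ennreal (L powr s) * ennreal (diam_powr s (U i)))"
    proof (intro suminf_le)
      fix i
      have "diam_powr s (V i) \<le> L powr s * diam_powr s (U i)"
      proof (cases "V i = {}")
        case False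
        then have "U i \<noteq> {}" by (auto simp: V_def)
        then show ?thesis
          using False s powr_mono2[OF _ diameter_ge_0[OF bV] dV, of s i] L d0
          by (simp add: diam_powr_def powr_mult)
      qed (simp add: diam_powr_def)
      then show "ennreal (diam_powr s (V i)) \<le> ennreal (L powr s) * ennreal (diam_powr s (U i))"
        by (simp flip: ennreal_mult)
    qed auto
    also have "\<dots> = ennreal (L powr s) * (\<Sum>i. ennreal (diam_powr s (U i)))"
      by (rule ennreal_suminf_cmult)
    finally have "ennreal (L powr - s) * hausdorff_premeasure s \<delta> E
        \<le> ennreal (L powr - s) * (ennreal (L powr s) * (\<Sum>i. ennreal (diam_powr s (U i))))"
      by (intro mult_left_mono) auto
    also have "\<dots> = (\<Sum>i. ennreal (diam_powr s (U i)))"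
      using L by (simp add: mult.assoc[symmetric] powr_minus flip: ennreal_mult)
    finally show ?thesis .
  qed
  have "ennreal (L powr - s) * hausdorff_premeasure s \<delta> E \<le> hausdorff_premeasure s \<delta> F"
    unfolding hausdorff_premeasure_def[of s \<delta> F] by (rule INF_greatest) (rule key)
  then have "ennreal (L powr s) * (ennreal (L powr - s) * hausdorff_premeasure s \<delta> E)
      \<le> ennreal (L powr s) * hausdorff_premeasure s \<delta> F"
    by (intro mult_left_mono) auto
  then show ?thesis
    using L by (simp add: mult.assoc[symmetric] powr_minus flip: ennreal_mult)
qed

lemma hausdorff_premeasure_unit_interval_le_1:
  fixes E :: "real set"
  assumes "E \<subseteq> {0..1}"
  shows "hausdorff_premeasure s 1 E \<le> 1"
proof -
  define U :: "nat \<Rightarrow> real set" where "U i = (if i = 0 then {0..1} else {})" for i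
  have "U \<in> delta_covers 1 E"
    using assms by (auto simp: delta_covers_def U_def)
  then have "hausdorff_premeasure s 1 E \<le> (\<Sum>i. ennreal (diam_powr s (U i)))"
    by (rule hausdorff_premeasure_le_cover)
  also have "\<dots> = (\<Sum>i\<in>{0}. ennreal (diam_powr s (U i)))"
    by (rule suminf_finite) (auto simp: U_def diam_powr_def)
  also have "\<dots> = 1" by (simp add: U_def diam_powr_def)
  finally show ?thesis .
qed

text \<open>
  A cover whose \<open>s\<close>-th powers of diameters have a small sum consists of sets of small diameter, so a
  null premeasure at scale 1 is null at every scale. Null sets can thus be treated without ever
  controlling \<open>\<delta>\<close>.
\<close>

lemma hausdorff_measure_eq_0_if_premeasure_eq_0:
  assumes s: "0 < s" and z: "hausdorff_premeasure s 1 E = 0"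
  shows "hausdorff_measure s E = 0"
proof -
  have "hausdorff_premeasure s \<delta> E \<le> ennreal e" if \<delta>: "0 < \<delta>" and e: "0 < e" for \<delta> e
  proof -
    define m where "m = min e (\<delta> powr s)"
    have "0 < m" using \<delta> e by (simp add: m_def)
    then have "hausdorff_premeasure s 1 E < ennreal m" using z by simp
    then obtain U where U: "U \<in> delta_covers 1 E" and sm: "(\<Sum>i. ennreal (diam_powr s (U i))) < ennreal m"
      unfolding hausdorff_premeasure_def INF_less_iff by blast
    have "diameter (U i) \<le> \<delta>" for i
    proof (cases "U i = {}")
      case False
      have "ennreal (diam_powr s (U i)) < ennreal m"
        using ennreal_suminf_lessD[OF sm] .
      then have "diameter (U i) powr s < \<delta> powr s"
        using False s by (simp add: diam_powr_def m_def ennreal_less_iff)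
      then show ?thesis
        using powr_mono2[of s \<delta> "diameter (U i)"] s \<delta> by fastforce
    qed (use \<delta> in simp)
    then have "U \<in> delta_covers \<delta> E" using U by (simp add: delta_covers_def)
    then have "hausdorff_premeasure s \<delta> E \<le> (\<Sum>i. ennreal (diam_powr s (U i)))"
      by (rule hausdorff_premeasure_le_cover)
    also have "\<dots> \<le> ennreal m" using sm by simp
    also have "\<dots> \<le> ennreal e" by (simp add: m_def ennreal_leI)
    finally show ?thesis .
  qed
  then have "hausdorff_premeasure s \<delta> E = 0" if "0 < \<delta>" for \<delta>
    using ennreal_le_epsilon[of 0 "hausdorff_premeasure s \<delta> E"] that by auto
  then show ?thesis by (simp add: hausdorff_measure_def SUP_eq_iff[of _ 0] )
qed

text \<open>
  This is the mass distribution principle with Lebesgue measure on \<open>[0, 1)\<close> as the mass: the preimage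
  of a covering set \<open>U\<close> has diameter at most \<open>C\<close> times the \<open>s\<close>-th power of the diameter of \<open>U\<close>, so
  it lies in an interval of twice that length, and these lengths add up to at least 1.
\<close>

lemma hausdorff_measure_nonzero_if_inverse_hoelder:
  fixes g :: "real \<Rightarrow> 'a::metric_space"
  assumes s: "0 < s" and C: "0 < C"
    and mem: "\<And>t. t \<in> {0..<1} \<Longrightarrow> g t \<in> E"
    and hoelder: "\<And>t u. t \<in> {0..<1} \<Longrightarrow> u \<in> {0..<1} \<Longrightarrow> \<bar>t - u\<bar> \<le> C * dist (g t) (g u) powr s"
  shows "hausdorff_measure s E \<noteq> 0"
proof
  assume z: "hausdorff_measure s E = 0"
  have "hausdorff_premeasure s 1 E \<le> hausdorff_measure s E"
    unfolding hausdorff_measure_def by (rule SUP_upper) simp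
  then have "hausdorff_premeasure s 1 E < ennreal (1 / (2 * C))" using z C by simp
  then obtain U where U: "U \<in> delta_covers 1 E"
    and sm: "(\<Sum>i. ennreal (diam_powr s (U i))) < ennreal (1 / (2 * C))"
    unfolding hausdorff_premeasure_def INF_less_iff by blast
  define P where "P i = {t \<in> {0..<1}. g t \<in> U i}" for i
  have "\<exists>J. P i \<subseteq> J \<and> J \<in> sets lborel \<and> emeasure lborel J \<le> ennreal (2 * C) * ennreal (diam_powr s (U i))" for i
  proof (cases "P i = {}")
    case False
    then obtain u where u: "u \<in> P i" by blast
    define r where "r = C * diam_powr s (U i)"
    have "U i \<noteq> {}" using u by (auto simp: P_def)
    have "t \<in> {u - r..u + r}" if "t \<in> P i" for t
    proof -
      have "\<bar>t - u\<bar> \<le> C * dist (g t) (g u) powr s" using that u hoelder by (auto simp: P_def)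
      also have "\<dots> \<le> C * diameter (U i) powr s"
        using that u U s C
        by (intro mult_left_mono powr_mono2 diameter_bounded_bound) (auto simp: P_def delta_covers_def)
      finally show ?thesis using s \<open>U i \<noteq> {}\<close> by (auto simp: r_def diam_powr_def)
    qed
    moreover have "emeasure lborel {u - r..u + r} = ennreal (2 * C) * ennreal (diam_powr s (U i))"
      using C by (simp add: r_def flip: ennreal_mult)
    ultimately show ?thesis by (intro exI[of _ "{u - r..u + r}"]) auto
  qed (auto intro: exI[of _ "{}"])
  then obtain J where J: "\<And>i. P i \<subseteq> J i" "\<And>i. J i \<in> sets lborel"
    "\<And>i. emeasure lborel (J i) \<le> ennreal (2 * C) * ennreal (diam_powr s (U i))"
    by metis
  have "{0..<1} \<subseteq> (\<Union>i. J i)"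
  proof
    fix t :: real assume t: "t \<in> {0..<1}"
    then obtain i where "g t \<in> U i" using mem[OF t] U by (auto simp: delta_covers_def)
    then have "t \<in> P i" using t by (simp add: P_def)
    then show "t \<in> (\<Union>i. J i)" using J(1) by blast
  qed
  then have "emeasure lborel {0..<1::real} \<le> emeasure lborel (\<Union>i. J i)"
    using J(2) by (intro emeasure_mono) auto
  also have "\<dots> \<le> (\<Sum>i. emeasure lborel (J i))"
    using J(2) by (intro emeasure_subadditive_countably) auto
  also have "\<dots> \<le> (\<Sum>i. ennreal (2 * C) * ennreal (diam_powr s (U i)))"
    by (intro suminf_le J) auto
  also have "\<dots> = ennreal (2 * C) * (\<Sum>i. ennreal (diam_powr s (U i)))"
    by (rule ennreal_suminf_cmult)
  also have "\<dots> < ennreal (2 * C) * ennreal (1 / (2 * C))"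
    using C sm by (intro ennreal_mult_strict_left_mono) auto
  also have "\<dots> = 1" using C by (simp flip: ennreal_mult)
  finally show False by simp
qed

text \<open>
  The exponent 0 is excluded in the lower estimates by powers, so it needs an argument of its own:
  each nonempty covering set counts 1.
\<close>

lemma empty_if_hausdorff_measure_0_eq_0:
  "hausdorff_measure 0 E = 0 \<Longrightarrow> E = {}"
proof (rule ccontr)
  assume z: "hausdorff_measure 0 E = 0" and E: "E \<noteq> {}"
  have "1 \<le> hausdorff_premeasure 0 1 E"
    unfolding hausdorff_premeasure_def
  proof (rule INF_greatest)
    fix U assume "U \<in> delta_covers 1 E"
    then have "E \<subseteq> (\<Union>i. U i)" by (simp add: delta_covers_def)
    then obtain i where "U i \<noteq> {}" using E by blast
    then have "1 = ennreal (diam_powr 0 (U i))" by (simp add: diam_powr_def)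
    also have "\<dots> = (\<Sum>j\<in>{i}. ennreal (diam_powr 0 (U j)))" by simp
    also have "\<dots> \<le> (\<Sum>j. ennreal (diam_powr 0 (U j)))" by (rule sum_le_suminf) auto
    finally show "1 \<le> (\<Sum>i. ennreal (diam_powr 0 (U i)))" .
  qed
  also have "\<dots> \<le> hausdorff_measure 0 E"
    unfolding hausdorff_measure_def by (rule SUP_upper) simp
  finally show False using z by simp
qed

lemma hausdorff_measure_empty: "hausdorff_measure s {} = 0"
  by (simp add: hausdorff_measure_def hausdorff_premeasure_empty less_imp_le)

lemma hausdorff_dim_eqI:
  fixes E :: "'a::metric_space set"
  assumes s: "0 < s"
    and above: "\<And>t. s < t \<Longrightarrow> hausdorff_measure t E = 0"
    and below: "\<And>t. 0 < t \<Longrightarrow> t < s \<Longrightarrow> hausdorff_measure t E \<noteq> 0"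
  shows "hausdorff_dim E = ereal s"
proof (rule antisym)
  have "hausdorff_dim E \<le> ereal t" if "s < t" for t
    unfolding hausdorff_dim_def using that s above by (intro INF_lower) auto
  then have "hausdorff_dim E \<le> ereal s + ereal e" if "0 < e" for e
    using that by simp
  then show "hausdorff_dim E \<le> ereal s"
    by (rule ereal_le_epsilon2)
  show "ereal s \<le> hausdorff_dim E"
    unfolding hausdorff_dim_def
  proof (rule INF_greatest)
    fix t assume t: "t \<in> {t. 0 \<le> t \<and> hausdorff_measure t E = 0}"
    have "E \<noteq> {}" using below[of "s / 2"] s by (auto simp: hausdorff_measure_empty)
    then have "t \<noteq> 0" using t empty_if_hausdorff_measure_0_eq_0 by auto
    then show "ereal s \<le> ereal t" using t below[of t] by (cases "t < s") auto
  qed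
qed

section \<open>Covering sums over digit blocks\<close>

lemma funpow_gauss_map_in: "x \<in> unit_irrationals \<Longrightarrow> (gauss_map ^^ l) x \<in> unit_irrationals"
  by (induction l) (auto intro: gauss_map_in)

lemma cf_coeff_funpow_gauss_map: "cf_coeff (Suc j) ((gauss_map ^^ l) x) = cf_coeff (Suc (j + l)) x"
  by (simp add: cf_coeff_def funpow_add)

text \<open>
  The factor by which a digit restricted to \<open>A\<close> enters a covering sum with exponent \<open>s\<close>. The digit 0,
  which never occurs, contributes nothing because \<open>0 powr x = 0\<close>.
\<close>

definition digit_weight :: "real \<Rightarrow> nat set \<Rightarrow> ennreal" where
  "digit_weight s A = (\<Sum>a. if a \<in> A then ennreal (real a powr - (2 * s)) else 0)"

text \<open>
  The points with first digit \<open>a\<close> are the image of their Gauss iterates under \<open>y \<mapsto> 1 / (a + y)\<close>,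
  which contracts distances on the nonnegative reals by the factor \<open>1 / a\<^sup>2\<close>.
\<close>

lemma hausdorff_premeasure_first_digit:
  assumes s: "0 < s" and a: "1 \<le> a"
  shows "hausdorff_premeasure s \<delta> {x \<in> unit_irrationals. cf_coeff 1 x = a \<and> gauss_map x \<in> F}
           \<le> ennreal (real a powr - (2 * s)) * hausdorff_premeasure s \<delta> F"
proof -
  define L where "L = 1 / (real a)\<^sup>2"
  have L: "0 < L" "L \<le> 1" using a by (auto simp: L_def)
  have "hausdorff_premeasure s \<delta> {x \<in> unit_irrationals. cf_coeff 1 x = a \<and> gauss_map x \<in> F}
      \<le> ennreal (L powr s) * hausdorff_premeasure s \<delta> F"
  proof (rule hausdorff_premeasure_lipschitz_image[where g = "\<lambda>y. 1 / (real a + y)" and D = "{0..}", OF s L])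
    show "{x \<in> unit_irrationals. cf_coeff 1 x = a \<and> gauss_map x \<in> F} \<subseteq> (\<lambda>y. 1 / (real a + y)) ` (F \<inter> {0..})"
    proof safe
      fix x assume x: "x \<in> unit_irrationals" and F: "gauss_map x \<in> F" and ax: "a = cf_coeff 1 x"
      have "x = 1 / (real (cf_coeff 1 x) + gauss_map x)"
        using cf_coeff_1(2)[OF x] by simp
      moreover have "gauss_map x \<ge> 0" using unit_irrationals_gt_0[OF gauss_map_in[OF x]] by simp
      ultimately show "x \<in> (\<lambda>y. 1 / (real (cf_coeff 1 x) + y)) ` (F \<inter> {0..})" using F by blast
    qed
  next
    fix y z :: real assume yz: "y \<in> {0..}" "z \<in> {0..}"
    have pos: "real a + y > 0" "real a + z > 0" using yz a by auto
    have "1 / (real a + y) - 1 / (real a + z) = (z - y) / ((real a + y) * (real a + z))"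
      using pos by (simp add: field_simps)
    then have "dist (1 / (real a + y)) (1 / (real a + z)) = dist y z / ((real a + y) * (real a + z))"
      using pos by (simp add: dist_real_def abs_mult)
    also have "\<dots> \<le> dist y z / (real a * real a)"
      using yz a by (intro divide_left_mono mult_mono mult_pos_pos) auto
    finally show "dist (1 / (real a + y)) (1 / (real a + z)) \<le> L * dist y z"
      by (simp add: L_def power2_eq_square)
  qed
  also have "L powr s = real a powr - (2 * s)"
    using a by (simp add: L_def powr_divide powr_minus powr_powr flip: powr_numeral) (simp add: field_simps)
  finally show ?thesis .
qed

text \<open>
  Splitting off one digit at a time, countable subadditivity turns the sum over all cylinders of order
  \<open>l\<close> into a product of one-digit sums, and the remaining condition \<open>F\<close> on the tail factors out.
\<close>

lemma hausdorff_premeasure_digit_block: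
  assumes s: "0 < s" and \<delta>: "0 \<le> \<delta>"
  shows "hausdorff_premeasure s \<delta>
           {x \<in> unit_irrationals. (\<forall>i<l. cf_coeff (Suc i) x \<in> A i) \<and> (gauss_map ^^ l) x \<in> F}
           \<le> (\<Prod>i<l. digit_weight s (A i)) * hausdorff_premeasure s \<delta> F"
proof (induction l arbitrary: A)
  case 0
  have "{x \<in> unit_irrationals. x \<in> F} \<subseteq> F" by blast
  then show ?case by (simp add: hausdorff_premeasure_mono)
next
  case (Suc l)
  define G where "G = {x \<in> unit_irrationals. (\<forall>i<l. cf_coeff (Suc i) x \<in> A (Suc i)) \<and> (gauss_map ^^ l) x \<in> F}"
  define E where "E a = (if a \<in> A 0 then {x \<in> unit_irrationals. cf_coeff 1 x = a \<and> gauss_map x \<in> G} else {})" for a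
  have "{x \<in> unit_irrationals. (\<forall>i<Suc l. cf_coeff (Suc i) x \<in> A i) \<and> (gauss_map ^^ Suc l) x \<in> F} \<subseteq> (\<Union>a. E a)"
  proof safe
    fix x assume x: "x \<in> unit_irrationals" and A: "\<forall>i<Suc l. cf_coeff (Suc i) x \<in> A i"
      and F: "(gauss_map ^^ Suc l) x \<in> F"
    have "gauss_map x \<in> G"
      using x A F by (auto simp: G_def gauss_map_in funpow_swap1 simp flip: cf_coeff_Suc)
    then have "x \<in> E (cf_coeff 1 x)" using A x by (auto simp: E_def)
    then show "x \<in> (\<Union>a. E a)" by blast
  qed
  then have "hausdorff_premeasure s \<delta> {x \<in> unit_irrationals. (\<forall>i<Suc l. cf_coeff (Suc i) x \<in> A i) \<and> (gauss_map ^^ Suc l) x \<in> F}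
      \<le> hausdorff_premeasure s \<delta> (\<Union>a. E a)"
    by (rule hausdorff_premeasure_mono)
  also have "\<dots> \<le> (\<Sum>a. hausdorff_premeasure s \<delta> (E a))"
    by (rule hausdorff_premeasure_countable_subadditive)
  also have "\<dots> \<le> (\<Sum>a. (if a \<in> A 0 then ennreal (real a powr - (2 * s)) else 0) * hausdorff_premeasure s \<delta> G)"
  proof (intro suminf_le)
    fix a
    show "hausdorff_premeasure s \<delta> (E a)
        \<le> (if a \<in> A 0 then ennreal (real a powr - (2 * s)) else 0) * hausdorff_premeasure s \<delta> G"
    proof (cases "a \<in> A 0 \<and> 1 \<le> a")
      case True
      then show ?thesis using hausdorff_premeasure_first_digit[OF s, of a \<delta> G] by (simp add: E_def)
    next
      case False
      then have "E a = {}" using cf_coeff_ge_1[of _ 1] by (auto simp: E_def)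
      then show ?thesis by (simp add: hausdorff_premeasure_empty[OF \<delta>])
    qed
  qed auto
  also have "\<dots> = digit_weight s (A 0) * hausdorff_premeasure s \<delta> G"
    unfolding digit_weight_def by (rule ennreal_suminf_multc)
  also have "\<dots> \<le> digit_weight s (A 0) * ((\<Prod>i<l. digit_weight s (A (Suc i))) * hausdorff_premeasure s \<delta> F)"
    unfolding G_def by (intro mult_left_mono Suc.IH) auto
  also have "\<dots> = (\<Prod>i<Suc l. digit_weight s (A i)) * hausdorff_premeasure s \<delta> F"
    by (simp add: prod.lessThan_Suc_shift mult.assoc del: prod.lessThan_Suc)
  finally show ?case .
qed

text \<open>
  The value at \<open>1 + d\<close> of the Riemann zeta function; the term with index 0 vanishes.
\<close>

definition zeta_sum :: "real \<Rightarrow> real" where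
  "zeta_sum d = (\<Sum>a. real a powr - (1 + d))"

lemma zeta_sum_sums: "0 < d \<Longrightarrow> (\<lambda>a. real a powr - (1 + d)) sums zeta_sum d"
  unfolding zeta_sum_def by (rule summable_sums) (simp add: summable_real_powr_iff)

lemma zeta_sum_ge_1: "0 < d \<Longrightarrow> 1 \<le> zeta_sum d"
  using sum_le_suminf[of "\<lambda>a. real a powr - (1 + d)" "{1}"] zeta_sum_sums[of d]
  by (auto simp: zeta_sum_def sums_iff)

text \<open>
  Half of the excess of the exponent \<open>2 s = 1 + 2 d\<close> over 1 is spent on the decay in \<open>T\<close>, the other
  half on the convergence of the series.
\<close>

lemma digit_weight_tail:
  assumes d: "0 < d" and T: "0 < T"
  shows "digit_weight (1 / 2 + d) {a. T \<le> real a} \<le> ennreal (T powr - d * zeta_sum d)"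
proof -
  have "digit_weight (1 / 2 + d) {a. T \<le> real a} \<le> (\<Sum>a. ennreal (T powr - d * real a powr - (1 + d)))"
    unfolding digit_weight_def
  proof (intro suminf_le)
    fix a
    have "real a powr - (2 * (1 / 2 + d)) \<le> T powr - d * real a powr - (1 + d)" if "T \<le> real a"
    proof -
      have "real a powr - (2 * (1 / 2 + d)) = real a powr - d * real a powr - (1 + d)"
        by (simp add: algebra_simps flip: powr_add)
      also have "\<dots> \<le> T powr - d * real a powr - (1 + d)"
        using that T d by (intro mult_right_mono powr_mono2') auto
      finally show ?thesis .
    qed
    then show "(if a \<in> {a. T \<le> real a} then ennreal (real a powr - (2 * (1 / 2 + d))) else 0)
        \<le> ennreal (T powr - d * real a powr - (1 + d))"
      by (auto intro: ennreal_leI)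
  qed auto
  also have "\<dots> = ennreal (T powr - d * zeta_sum d)"
    by (rule suminf_ennreal_eq) (use sums_mult[OF zeta_sum_sums[OF d]] in auto)
  finally show ?thesis .
qed

lemma digit_weight_UNIV:
  assumes d: "0 < d"
  shows "digit_weight (1 / 2 + d) UNIV \<le> ennreal (zeta_sum d)"
proof -
  have "digit_weight (1 / 2 + d) UNIV = digit_weight (1 / 2 + d) {a. 1 \<le> real a}"
    unfolding digit_weight_def by (intro suminf_cong) (auto simp: not_le)
  then show ?thesis using digit_weight_tail[OF d, of 1] by simp
qed

text \<open>
  A union bound over the position of the large digit, which accounts for the factor \<open>l\<close>.
\<close>

lemma hausdorff_premeasure_large_digit:
  assumes d: "0 < d" and T: "0 < T" and \<delta>: "0 \<le> \<delta>"
  shows "hausdorff_premeasure (1 / 2 + d) \<delta>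
           {x \<in> unit_irrationals. (\<exists>j<l. T \<le> real (cf_coeff (Suc j) x)) \<and> (gauss_map ^^ l) x \<in> F}
           \<le> ennreal (real l * zeta_sum d ^ l * T powr - d) * hausdorff_premeasure (1 / 2 + d) \<delta> F"
proof -
  let ?h = "hausdorff_premeasure (1 / 2 + d) \<delta>"
  define A where "A j i = (if i = j then {a. T \<le> real a} else UNIV)" for i j :: nat
  define E where "E j = {x \<in> unit_irrationals. (\<forall>i<l. cf_coeff (Suc i) x \<in> A j i) \<and> (gauss_map ^^ l) x \<in> F}" for j
  have Z: "0 \<le> zeta_sum d" using zeta_sum_ge_1[OF d] by simp
  have bound: "?h (E j) \<le> ennreal (zeta_sum d ^ l * T powr - d) * ?h F" if j: "j < l" for j
  proof -
    have "?h (E j) \<le> (\<Prod>i<l. digit_weight (1 / 2 + d) (A j i)) * ?h F"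
      unfolding E_def by (rule hausdorff_premeasure_digit_block) (use d \<delta> in auto)
    also have "(\<Prod>i<l. digit_weight (1 / 2 + d) (A j i))
        \<le> (\<Prod>i<l. ennreal (if i = j then T powr - d * zeta_sum d else zeta_sum d))"
      by (intro prod_mono_ennreal) (auto simp: A_def digit_weight_tail digit_weight_UNIV d T)
    also have "\<dots> = ennreal (\<Prod>i<l. if i = j then T powr - d * zeta_sum d else zeta_sum d)"
      using Z by (intro prod_ennreal) auto
    also have "(\<Prod>i<l. if i = j then T powr - d * zeta_sum d else zeta_sum d)
        = (\<Prod>i<l. (if i = j then T powr - d else 1) * zeta_sum d)"
      by (intro prod.cong) auto
    also have "\<dots> = zeta_sum d ^ l * T powr - d"
      using j by (simp add: prod.distrib)
    finally show ?thesis by (simp add: mult_right_mono)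
  qed
  have "{x \<in> unit_irrationals. (\<exists>j<l. T \<le> real (cf_coeff (Suc j) x)) \<and> (gauss_map ^^ l) x \<in> F} \<subseteq> (\<Union>j\<in>{..<l}. E j)"
    by (auto simp: E_def A_def)
  then have "?h {x \<in> unit_irrationals. (\<exists>j<l. T \<le> real (cf_coeff (Suc j) x)) \<and> (gauss_map ^^ l) x \<in> F}
      \<le> ?h (\<Union>j\<in>{..<l}. E j)" by (rule hausdorff_premeasure_mono)
  also have "\<dots> \<le> (\<Sum>j<l. ?h (E j))"
    by (rule hausdorff_premeasure_finite_subadditive) (use \<delta> in auto)
  also have "\<dots> \<le> (\<Sum>j<l. ennreal (zeta_sum d ^ l * T powr - d) * ?h F)"
    by (intro sum_mono bound) auto
  also have "\<dots> = ennreal (real l * zeta_sum d ^ l * T powr - d) * ?h F"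
    using Z by (simp add: ennreal_mult ennreal_of_nat_eq_real_of_nat mult.assoc)
  finally show ?thesis .
qed

text \<open>
  Let \<open>E k\<close> be the set of tails that meet the conditions from block \<open>k\<close> on. If each block costs at most
  a factor \<open>1 / 2\<close>, then the premeasure of \<open>E k\<close> is at most half of that of \<open>E (Suc k)\<close>; as all of
  them are bounded by 1, they vanish. The finitely many digits before block \<open>K\<close> only contribute a
  finite factor.
\<close>

lemma hausdorff_premeasure_recurrent_large_digits:
  fixes n :: "nat \<Rightarrow> nat" and T :: "nat \<Rightarrow> real"
  assumes d: "0 < d" and n: "mono n" and T: "\<And>k. K \<le> k \<Longrightarrow> 0 < T k"
    and small: "\<And>k. K \<le> k \<Longrightarrow>
      real (n (Suc k) - n k) * zeta_sum d ^ (n (Suc k) - n k) * T k powr - d \<le> 1 / 2"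
  shows "hausdorff_premeasure (1 / 2 + d) 1
           {x \<in> unit_irrationals. \<forall>k\<ge>K. \<exists>j\<in>{n k..<n (Suc k)}. T k \<le> real (cf_coeff (Suc j) x)} = 0"
proof -
  let ?h = "hausdorff_premeasure (1 / 2 + d) 1"
  define E where "E k = {x \<in> unit_irrationals. \<forall>i\<ge>k. \<exists>j\<in>{n i..<n (Suc i)}.
      T i \<le> real (cf_coeff (Suc (j - n k)) x)}" for k
  have step: "?h (E k) \<le> ennreal (1 / 2) * ?h (E (Suc k))" if k: "K \<le> k" for k
  proof -
    define l where "l = n (Suc k) - n k"
    have nk: "n k \<le> n (Suc k)" using n by (simp add: mono_def)
    have "E k \<subseteq> {x \<in> unit_irrationals. (\<exists>j<l. T k \<le> real (cf_coeff (Suc j) x)) \<and> (gauss_map ^^ l) x \<in> E (Suc k)}"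
    proof
      fix x assume x: "x \<in> E k"
      have xI: "x \<in> unit_irrationals" using x by (simp add: E_def)
      obtain j where "j \<in> {n k..<n (Suc k)}" "T k \<le> real (cf_coeff (Suc (j - n k)) x)"
        using x by (auto simp: E_def)
      then have "\<exists>j<l. T k \<le> real (cf_coeff (Suc j) x)"
        by (intro exI[of _ "j - n k"]) (auto simp: l_def)
      moreover have "(gauss_map ^^ l) x \<in> E (Suc k)"
      proof -
        have "\<exists>j\<in>{n i..<n (Suc i)}. T i \<le> real (cf_coeff (Suc (j - n (Suc k))) ((gauss_map ^^ l) x))"
          if i: "Suc k \<le> i" for i
        proof -
          obtain j where j: "j \<in> {n i..<n (Suc i)}" "T i \<le> real (cf_coeff (Suc (j - n k)) x)"
            using x Suc_leD[OF i] unfolding E_def by blast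
          have "n (Suc k) \<le> n i" using n i by (simp add: mono_def)
          then have "j - n (Suc k) + l = j - n k" using j nk by (simp add: l_def)
          then show ?thesis using j by (intro bexI[of _ j]) (auto simp: cf_coeff_funpow_gauss_map)
        qed
        then show ?thesis using funpow_gauss_map_in[OF xI] by (simp add: E_def)
      qed
      ultimately show "x \<in> {x \<in> unit_irrationals. (\<exists>j<l. T k \<le> real (cf_coeff (Suc j) x)) \<and> (gauss_map ^^ l) x \<in> E (Suc k)}"
        using xI by simp
    qed
    then have "?h (E k) \<le> ?h {x \<in> unit_irrationals. (\<exists>j<l. T k \<le> real (cf_coeff (Suc j) x)) \<and> (gauss_map ^^ l) x \<in> E (Suc k)}"
      by (rule hausdorff_premeasure_mono)
    also have "\<dots> \<le> ennreal (real l * zeta_sum d ^ l * T k powr - d) * ?h (E (Suc k))"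
      by (rule hausdorff_premeasure_large_digit) (use d T k in auto)
    also have "\<dots> \<le> ennreal (1 / 2) * ?h (E (Suc k))"
      using small[OF k] by (intro mult_right_mono ennreal_leI) (auto simp: l_def)
    finally show ?thesis .
  qed
  have iter: "?h (E k) \<le> ennreal ((1 / 2) ^ m)" if "K \<le> k" for k m
    using that
  proof (induction m arbitrary: k)
    case 0
    have "E k \<subseteq> {0..1}" using unit_irrationals_gt_0 by (force simp: E_def)
    then show ?case using hausdorff_premeasure_unit_interval_le_1 by simp
  next
    case (Suc m)
    have "?h (E k) \<le> ennreal (1 / 2) * ?h (E (Suc k))" by (rule step) (use Suc.prems in simp)
    also have "\<dots> \<le> ennreal (1 / 2) * ennreal ((1 / 2) ^ m)"
      by (intro mult_left_mono Suc.IH) (use Suc.prems in auto)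
    also have "\<dots> = ennreal ((1 / 2) ^ Suc m)" by (subst ennreal_mult[symmetric]) auto
    finally show ?case .
  qed
  have "?h (E K) \<le> 0"
  proof (rule ennreal_le_epsilon)
    fix e :: real assume "0 < e"
    then obtain m where "(1 / 2 :: real) ^ m < e" using real_arch_pow_inv[of e "1/2"] by auto
    then show "?h (E K) \<le> 0 + ennreal e"
      using order_trans[OF iter[of K m] ennreal_leI[of "(1 / 2) ^ m" e]] by simp
  qed
  then have EK: "?h (E K) = 0" by simp
  have "{x \<in> unit_irrationals. \<forall>k\<ge>K. \<exists>j\<in>{n k..<n (Suc k)}. T k \<le> real (cf_coeff (Suc j) x)}
      \<subseteq> {x \<in> unit_irrationals. (\<forall>i<n K. cf_coeff (Suc i) x \<in> UNIV) \<and> (gauss_map ^^ n K) x \<in> E K}"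
  proof safe
    fix x assume xI: "x \<in> unit_irrationals"
      and x: "\<forall>k\<ge>K. \<exists>j\<in>{n k..<n (Suc k)}. T k \<le> real (cf_coeff (Suc j) x)"
    have "\<exists>j\<in>{n i..<n (Suc i)}. T i \<le> real (cf_coeff (Suc (j - n K)) ((gauss_map ^^ n K) x))" if i: "K \<le> i" for i
    proof -
      obtain j where j: "j \<in> {n i..<n (Suc i)}" "T i \<le> real (cf_coeff (Suc j) x)"
        using x i by blast
      have "n K \<le> n i" using n i by (simp add: mono_def)
      then show ?thesis using j by (intro bexI[of _ j]) (auto simp: cf_coeff_funpow_gauss_map)
    qed
    then show "(gauss_map ^^ n K) x \<in> E K" using funpow_gauss_map_in[OF xI] by (simp add: E_def)
  qed auto
  then have "?h {x \<in> unit_irrationals. \<forall>k\<ge>K. \<exists>j\<in>{n k..<n (Suc k)}. T k \<le> real (cf_coeff (Suc j) x)}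
      \<le> ?h {x \<in> unit_irrationals. (\<forall>i<n K. cf_coeff (Suc i) x \<in> UNIV) \<and> (gauss_map ^^ n K) x \<in> E K}"
    by (rule hausdorff_premeasure_mono)
  also have "\<dots> \<le> (\<Prod>i<n K. digit_weight (1 / 2 + d) UNIV) * ?h (E K)"
    by (rule hausdorff_premeasure_digit_block) (use d in auto)
  finally show ?thesis using EK by simp
qed

section \<open>Sums growing at least like $\exp(c\sqrt n)$\<close>

lemma block_cost_tendsto_0:
  fixes d \<gamma> :: real
  assumes "0 < d" "0 < \<gamma>"
  shows "(\<lambda>k::nat. C * ((2 * real k + 2) powr (1 + d) * exp (- \<gamma> * (2 * real k + 1)))) \<longlonglongrightarrow> 0"
proof -
  have "(\<lambda>k::nat. (2 * real k + 2) powr (1 + d) * exp (- \<gamma> * (2 * real k + 1))) \<longlonglongrightarrow> 0"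
    using assms by real_asymp
  then show ?thesis by (rule tendsto_mult_right_zero)
qed

text \<open>
  Consecutive blocks are separated at the times \<open>k\<^sup>2 div M\<^sup>2\<close>. The constant \<open>M\<close> is chosen so large that the decay \<open>T\<^bsup>-d\<^esup>\<close> coming from
  the large digit in a block beats the factor \<open>zeta_sum d\<close> paid for each digit of the block.
\<close>

lemma hausdorff_measure_cf_sum_set_eq_0:
  fixes \<phi> :: "nat \<Rightarrow> real"
  assumes c: "0 < c" and s: "1 / 2 < s"
    and growth: "\<And>m n. 1 \<le> m \<Longrightarrow> m \<le> n \<Longrightarrow> \<phi> m * exp (c * (sqrt (real n) - sqrt (real m))) \<le> \<phi> n"
    and large: "\<And>n. 1 \<le> n \<Longrightarrow> exp (c * sqrt (real n)) \<le> \<phi> n"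
  shows "hausdorff_measure s {x \<in> unit_irrationals. (\<lambda>n. real (cf_sum n x) / \<phi> n) \<longlonglongrightarrow> 1} = 0"
proof -
  define d where "d = s - 1 / 2"
  have d: "0 < d" and s_eq: "s = 1 / 2 + d" using s by (auto simp: d_def)
  define \<kappa> where "\<kappa> = ln (zeta_sum d)"
  have Z: "1 \<le> zeta_sum d" by (rule zeta_sum_ge_1[OF d])
  have \<kappa>: "0 \<le> \<kappa>" and expl: "exp \<kappa> = zeta_sum d" using Z by (auto simp: \<kappa>_def)
  obtain M :: nat where M: "2 * \<kappa> / (d * c) < real M" using reals_Archimedean2 by blast
  have M0: "0 < real M"
    using M \<kappa> d c by (smt (verit) divide_nonneg_pos mult_pos_pos)
  \<comment> \<open>\<open>2 \<gamma>\<close> is the net rate at which the cost of block \<open>k\<close> decays exponentially in \<open>k\<close>.\<close>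
  define \<gamma> where "\<gamma> = d * c / (2 * real M) - \<kappa> / (real M)\<^sup>2"
  have \<gamma>: "0 < \<gamma>"
  proof -
    have "2 * \<kappa> < real M * (d * c)" using M d c by (simp add: divide_less_eq)
    then show ?thesis using M0 by (simp add: \<gamma>_def field_simps power2_eq_square)
  qed
  \<comment> \<open>The factor \<open>1 / q > 1\<close> is a lower bound for the growth of \<open>\<phi>\<close> over a late block.\<close>
  define q where "q = exp (- (c / (2 * real M)))"
  have q: "0 < q" "q < 1" using c M0 by (auto simp: q_def)
  define \<rho> where "\<rho> = (1 - q) / 2"
  have \<rho>: "0 < \<rho>" using q by (simp add: \<rho>_def)
  define n where "n k = k\<^sup>2 div M\<^sup>2" for k
  have n_upper: "real (n k) \<le> (real k / real M)\<^sup>2" for k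
    unfolding n_def using of_nat_div_le_of_nat[of "k\<^sup>2" "M\<^sup>2", where 'a = real] by (simp add: power_divide)
  have n_lower: "(real k / real M)\<^sup>2 - 1 < real (n k)" for k
  proof -
    have "k\<^sup>2 < M\<^sup>2 * (n k + 1)"
      using dividend_less_times_div[of "M\<^sup>2" "k\<^sup>2"] M0 by (simp add: n_def)
    then have "real (k\<^sup>2) < real (M\<^sup>2 * (n k + 1))" by (simp only: of_nat_less_iff)
    then have "(real k)\<^sup>2 < (real M)\<^sup>2 * (real (n k) + 1)"
      by (simp add: algebra_simps)
    then show ?thesis using M0 by (simp add: power_divide divide_less_eq algebra_simps)
  qed
  have mono_n: "mono n"
    unfolding n_def by (intro monoI div_le_mono power_mono) auto
  have sqrt_upper: "sqrt (real (n k)) \<le> real k / real M" for k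
    using real_sqrt_le_mono[OF n_upper[of k]] M0 by simp
  have sqrt_lower: "(real k + 1 / 2) / real M \<le> sqrt (real (n (Suc k)))" if k: "M\<^sup>2 \<le> k" for k
  proof (rule real_le_rsqrt)
    have "(real M)\<^sup>2 \<le> real k" using k by (metis of_nat_le_iff of_nat_power)
    then have "real M * real M * (4 * (real M * real M)) \<le> real M * real M * (3 + 4 * real k)"
      by (intro mult_left_mono) (auto simp: power2_eq_square)
    then have "((real k + 1 / 2) / real M)\<^sup>2 \<le> (real (Suc k) / real M)\<^sup>2 - 1"
      using M0 by (simp add: field_simps power2_eq_square)
    then show "((real k + 1 / 2) / real M)\<^sup>2 \<le> real (n (Suc k))" using n_lower[of "Suc k"] by simp
  qed
  define l where "l k = n (Suc k) - n k" for k
  have l_eq: "real (l k) = real (n (Suc k)) - real (n k)" for k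
    using mono_n by (simp add: l_def mono_def)
  have l_upper: "real (l k) \<le> (2 * real k + 1) / (real M)\<^sup>2 + 1" for k
  proof -
    have "real (l k) \<le> (real (Suc k) / real M)\<^sup>2 - (real k / real M)\<^sup>2 + 1"
      using n_upper[of "Suc k"] n_lower[of k] by (simp add: l_eq)
    also have "\<dots> = (2 * real k + 1) / (real M)\<^sup>2 + 1"
      by (simp add: power_divide power2_eq_square algebra_simps flip: diff_divide_distrib)
    finally show ?thesis .
  qed
  have l_upper': "real (l k) \<le> 2 * real k + 2" for k
  proof -
    have "1 \<le> (real M)\<^sup>2" using M0 by (simp add: Suc_leI)
    then have "(2 * real k + 1) / (real M)\<^sup>2 \<le> 2 * real k + 1"
      using M0 by (simp add: divide_le_eq mult_le_cancel_left1)
    then show ?thesis using l_upper[of k] by simp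
  qed
  have sqrt_gap: "1 / (2 * real M) \<le> sqrt (real (n (Suc k))) - sqrt (real (n k))" if "M\<^sup>2 \<le> k" for k
    using sqrt_lower[OF that] sqrt_upper[of k] by (simp add: add_divide_distrib)
  have l_pos: "0 < l k" if "M\<^sup>2 \<le> k" for k
  proof -
    have "0 < 1 / (2 * real M)" using M0 by simp
    then have "sqrt (real (n k)) < sqrt (real (n (Suc k)))" using sqrt_gap[OF that] by linarith
    then show ?thesis by (simp add: l_def)
  qed
  define T where "T k = \<rho> * exp (c * ((real k + 1 / 2) / real M)) / real (l k)" for k
  have T_pos: "0 < T k" if "M\<^sup>2 \<le> k" for k
    using l_pos[OF that] \<rho> by (simp add: T_def)
  have cost: "real (l k) * zeta_sum d ^ l k * T k powr - d
      \<le> \<rho> powr - d * exp \<kappa> * ((2 * real k + 2) powr (1 + d) * exp (- \<gamma> * (2 * real k + 1)))"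
    if k: "M\<^sup>2 \<le> k" for k
  proof -
    have "T k powr - d = \<rho> powr - d * exp (- (d * c * ((real k + 1 / 2) / real M))) * real (l k) powr d"
      using \<rho> l_pos[OF k]
      by (simp add: T_def powr_divide powr_mult powr_minus exp_minus divide_simps) (simp add: powr_def mult_ac)
    moreover have "zeta_sum d ^ l k = exp (\<kappa> * real (l k))"
      by (simp add: exp_of_nat2_mult flip: expl)
    moreover have "real (l k) * real (l k) powr d = real (l k) powr (1 + d)"
      using l_pos[OF k] by (simp add: powr_add)
    ultimately have "real (l k) * zeta_sum d ^ l k * T k powr - d
        = \<rho> powr - d * real (l k) powr (1 + d) * (exp (\<kappa> * real (l k)) * exp (- (d * c * ((real k + 1 / 2) / real M))))"
      by (simp add: mult_ac)
    also have "\<dots> \<le> \<rho> powr - d * real (l k) powr (1 + d) * (exp \<kappa> * exp (- \<gamma> * (2 * real k + 1)))"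
    proof (rule mult_left_mono)
      have "\<kappa> * real (l k) \<le> \<kappa> * ((2 * real k + 1) / (real M)\<^sup>2 + 1)"
        using l_upper \<kappa> by (intro mult_left_mono)
      moreover have "\<kappa> * ((2 * real k + 1) / (real M)\<^sup>2 + 1) - d * c * ((real k + 1 / 2) / real M)
          = \<kappa> - \<gamma> * (2 * real k + 1)"
        using M0 by (simp add: \<gamma>_def field_simps power2_eq_square)
      ultimately show "exp (\<kappa> * real (l k)) * exp (- (d * c * ((real k + 1 / 2) / real M)))
          \<le> exp \<kappa> * exp (- \<gamma> * (2 * real k + 1))" by (simp flip: exp_add)
    qed simp
    also have "\<dots> \<le> \<rho> powr - d * (2 * real k + 2) powr (1 + d) * (exp \<kappa> * exp (- \<gamma> * (2 * real k + 1)))"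
      using l_upper' d by (intro mult_right_mono mult_left_mono powr_mono2) auto
    finally show ?thesis by (simp add: mult_ac)
  qed
  have "eventually (\<lambda>k. \<rho> powr - d * exp \<kappa> * ((2 * real k + 2) powr (1 + d) * exp (- \<gamma> * (2 * real k + 1))) < 1 / 2) sequentially"
    by (rule order_tendstoD(2)[OF block_cost_tendsto_0[OF d \<gamma>]]) simp
  then obtain K1 where K1: "\<And>k. K1 \<le> k \<Longrightarrow>
      \<rho> powr - d * exp \<kappa> * ((2 * real k + 2) powr (1 + d) * exp (- \<gamma> * (2 * real k + 1))) < 1 / 2"
    by (auto simp: eventually_sequentially)
  define K0 where "K0 = K1 + M\<^sup>2"
  define W where "W K = {x \<in> unit_irrationals. \<forall>k\<ge>K. \<exists>j\<in>{n k..<n (Suc k)}. T k \<le> real (cf_coeff (Suc j) x)}" for K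
  have W: "hausdorff_premeasure s 1 (W (K0 + K)) = 0" for K
    unfolding W_def s_eq
  proof (rule hausdorff_premeasure_recurrent_large_digits[OF d mono_n])
    fix k assume "K0 + K \<le> k"
    then have k: "M\<^sup>2 \<le> k" "K1 \<le> k" by (auto simp: K0_def)
    show "0 < T k" by (rule T_pos[OF k(1)])
    show "real (n (Suc k) - n k) * zeta_sum d ^ (n (Suc k) - n k) * T k powr - d \<le> 1 / 2"
      using cost[OF k(1)] K1[OF k(2)] by (simp add: l_def)
  qed
  have "{x \<in> unit_irrationals. (\<lambda>n. real (cf_sum n x) / \<phi> n) \<longlonglongrightarrow> 1} \<subseteq> (\<Union>K. W (K0 + K))"
  proof safe
    fix x assume xI: "x \<in> unit_irrationals" and lim: "(\<lambda>n. real (cf_sum n x) / \<phi> n) \<longlonglongrightarrow> 1"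
    \<comment> \<open>With this relative error in \<open>S\<^sub>n / \<phi>(n)\<close> at both ends, the sum over a block is still at least \<open>\<rho> \<phi>\<close>.\<close>
    define \<epsilon> where "\<epsilon> = (1 - q) / 4"
    have \<epsilon>: "0 < \<epsilon>" using q by (simp add: \<epsilon>_def)
    obtain N where N: "\<And>m. N \<le> m \<Longrightarrow> \<bar>real (cf_sum m x) / \<phi> m - 1\<bar> < \<epsilon>"
      using LIMSEQ_D[OF lim \<epsilon>] by auto
    have near: "(1 - \<epsilon>) * \<phi> m \<le> real (cf_sum m x)" "real (cf_sum m x) \<le> (1 + \<epsilon>) * \<phi> m"
      if "N \<le> m" "1 \<le> m" for m
    proof -
      have pos: "0 < \<phi> m" using large[OF that(2)] by (smt (verit) exp_gt_zero)
      have "1 - \<epsilon> \<le> real (cf_sum m x) / \<phi> m" "real (cf_sum m x) / \<phi> m \<le> 1 + \<epsilon>"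
        using N[OF that(1)] by linarith+
      then show "(1 - \<epsilon>) * \<phi> m \<le> real (cf_sum m x)" "real (cf_sum m x) \<le> (1 + \<epsilon>) * \<phi> m"
        using pos by (simp_all add: pos_le_divide_eq pos_divide_le_eq)
    qed
    \<comment> \<open>From this index on, the block starts after \<open>N\<close>.\<close>
    define K where "K = M * (N + 1)"
    have "x \<in> W (K0 + K)"
      unfolding W_def
    proof (intro CollectI conjI allI impI xI)
      fix k assume kK: "K0 + K \<le> k"
      then have k: "M\<^sup>2 \<le> k" by (simp add: K0_def)
      have "N + 1 \<le> n k"
      proof -
        have "M * (N + 1) \<le> k" using kK by (simp add: K_def)
        then have "(M * (N + 1))\<^sup>2 \<le> k\<^sup>2" by (rule power_mono) simp
        then have "(N + 1)\<^sup>2 \<le> n k"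
          using M0 by (simp add: n_def less_eq_div_iff_mult_less_eq mult.commute flip: power_mult_distrib)
        moreover have "N + 1 \<le> (N + 1)\<^sup>2" by (simp add: power2_eq_square)
        ultimately show ?thesis by simp
      qed
      moreover have nn: "n k \<le> n (Suc k)" using mono_n by (simp add: mono_def)
      ultimately have nk: "N \<le> n k" "1 \<le> n k" "N \<le> n (Suc k)" "1 \<le> n (Suc k)" by auto
      have "c * (1 / (2 * real M)) \<le> c * (sqrt (real (n (Suc k))) - sqrt (real (n k)))"
        using sqrt_gap[OF k] c by (intro mult_left_mono) auto
      moreover have "0 \<le> \<phi> (n k)"
        using large[OF nk(2)] by (rule order_trans[OF less_imp_le[OF exp_gt_zero]])
      ultimately have "\<phi> (n k) * exp (c * (1 / (2 * real M))) \<le> \<phi> (n k) * exp (c * (sqrt (real (n (Suc k))) - sqrt (real (n k))))"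
        by (intro mult_left_mono) auto
      also have "\<dots> \<le> \<phi> (n (Suc k))" by (rule growth[OF nk(2) nn])
      finally have phi_q: "\<phi> (n k) \<le> q * \<phi> (n (Suc k))"
        by (simp add: q_def exp_minus field_simps)
      have phi_pos: "0 \<le> \<phi> (n (Suc k))"
        using large[OF nk(4)] by (smt (verit) exp_gt_zero)
      have "T k * real (l k) = \<rho> * exp (c * ((real k + 1 / 2) / real M))"
        using l_pos[OF k] by (simp add: T_def)
      also have "\<dots> \<le> \<rho> * exp (c * sqrt (real (n (Suc k))))"
        using mult_left_mono[OF sqrt_lower[OF k], of c] c \<rho> by simp
      also have "\<dots> \<le> \<rho> * \<phi> (n (Suc k))"
        using large[OF nk(4)] \<rho> by simp
      also have "\<dots> \<le> (1 - \<epsilon>) * \<phi> (n (Suc k)) - (1 + \<epsilon>) * (q * \<phi> (n (Suc k)))"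
      proof -
        have "\<epsilon> * q \<le> \<epsilon>" using q \<epsilon> by simp
        then have "\<rho> \<le> (1 - \<epsilon>) - (1 + \<epsilon>) * q"
          by (simp add: \<rho>_def \<epsilon>_def field_simps)
        from mult_right_mono[OF this phi_pos] show ?thesis by (simp add: algebra_simps)
      qed
      also have "\<dots> \<le> (1 - \<epsilon>) * \<phi> (n (Suc k)) - (1 + \<epsilon>) * \<phi> (n k)"
        using mult_left_mono[OF phi_q, of "1 + \<epsilon>"] \<epsilon> by simp
      also have "\<dots> \<le> real (cf_sum (n (Suc k)) x) - real (cf_sum (n k) x)"
        using near(1)[OF nk(3,4)] near(2)[OF nk(1,2)] by simp
      also have "\<dots> = (\<Sum>j\<in>{n k..<n (Suc k)}. real (cf_coeff (Suc j) x))"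
      proof -
        have "real (cf_sum m x) = (\<Sum>j<m. real (cf_coeff (Suc j) x))" for m
          unfolding cf_sum_def by (simp add: sum.atLeast1_atMost_eq)
        then show ?thesis using sum_diff_nat_ivl[of 0 "n k" "n (Suc k)" "\<lambda>j. real (cf_coeff (Suc j) x)"] nn
          by (simp add: lessThan_atLeast0)
      qed
      finally have sum_large: "T k * real (l k) \<le> (\<Sum>j\<in>{n k..<n (Suc k)}. real (cf_coeff (Suc j) x))" .
      show "\<exists>j\<in>{n k..<n (Suc k)}. T k \<le> real (cf_coeff (Suc j) x)"
      proof (rule ccontr)
        \<comment> \<open>Otherwise all \<open>l k\<close> digits of the block stay below the average required of them.\<close>
        assume "\<not> ?thesis"
        then have "(\<Sum>j\<in>{n k..<n (Suc k)}. real (cf_coeff (Suc j) x)) < (\<Sum>j\<in>{n k..<n (Suc k)}. T k)"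
          using l_pos[OF k] by (intro sum_strict_mono) (auto simp: l_def not_le)
        also have "\<dots> = T k * real (l k)" by (simp add: l_def)
        finally show False using sum_large by simp
      qed
    qed
    then show "x \<in> (\<Union>K. W (K0 + K))" by blast
  qed
  then have "hausdorff_premeasure s 1 {x \<in> unit_irrationals. (\<lambda>n. real (cf_sum n x) / \<phi> n) \<longlonglongrightarrow> 1}
      \<le> hausdorff_premeasure s 1 (\<Union>K. W (K0 + K))" by (rule hausdorff_premeasure_mono)
  also have "\<dots> \<le> (\<Sum>K. hausdorff_premeasure s 1 (W (K0 + K)))"
    by (rule hausdorff_premeasure_countable_subadditive)
  also have "\<dots> = 0" using W by simp
  finally show ?thesis using s by (intro hausdorff_measure_eq_0_if_premeasure_eq_0) auto
qed

section \<open>Continued fractions with prescribed digits\<close>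

lemma cf_convergent_Suc_Suc:
  "cf_convergent (Suc (Suc n)) a =
     1 / (real (a 1) + 1 / (real (a 2) + cf_convergent n (\<lambda>k. a (Suc (Suc k)))))"
  by (simp add: numeral_2_eq_2)

lemma cf_convergent_distance:
  assumes "\<And>k. 1 \<le> k \<Longrightarrow> 1 \<le> a k" "n \<le> m"
  shows "\<bar>cf_convergent n a - cf_convergent m a\<bar> \<le> 2 * (1 / 2) ^ n"
  using assms
proof (induction n arbitrary: a m rule: induct_nat_012)
  case 0
  then show ?case using cf_convergent_bounds[of a m] by simp
next
  case 1
  have "0 \<le> cf_convergent k a \<and> cf_convergent k a \<le> 1" for k
    by (rule cf_convergent_bounds) (use 1 in auto)
  from this[of "Suc 0"] this[of m] have "\<bar>cf_convergent (Suc 0) a - cf_convergent m a\<bar> \<le> 1"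
    by linarith
  then show ?case by simp
next
  case (ge2 n)
  obtain m' where m: "m = Suc (Suc m')" using ge2.prems(2) by (metis Suc_le_D Suc_le_mono)
  define b where "b k = a (Suc (Suc k))" for k
  have b: "\<And>k. 1 \<le> k \<Longrightarrow> 1 \<le> b k" using ge2.prems(1) by (simp add: b_def)
  have "1 \<le> real (a 1)" "1 \<le> real (a 2)" using ge2.prems(1)[of 1] ge2.prems(1)[of 2] by auto
  then have "\<bar>cf_convergent (Suc (Suc n)) a - cf_convergent m a\<bar> \<le> \<bar>cf_convergent n b - cf_convergent m' b\<bar> / 4"
    using cf_convergent_bounds[OF b] unfolding m cf_convergent_Suc_Suc b_def[symmetric]
    by (intro cf_two_step_contraction) auto
  also have "\<dots> \<le> 2 * (1 / 2) ^ n / 4"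
    using ge2.IH(1)[of b m'] b ge2.prems(2) m by simp
  finally show ?case by simp
qed

lemma cf_convergent_converges:
  assumes "\<And>k. 1 \<le> k \<Longrightarrow> 1 \<le> a k"
  obtains x where "(\<lambda>n. cf_convergent n a) \<longlonglongrightarrow> x"
proof -
  have "Cauchy (\<lambda>n. cf_convergent n a)"
  proof (rule CauchyI')
    fix e :: real assume "0 < e"
    then obtain N where N: "(1 / 2 :: real) ^ N < e / 2" using real_arch_pow_inv[of "e / 2" "1/2"] by auto
    show "\<exists>M. \<forall>m\<ge>M. \<forall>n>m. dist (cf_convergent m a) (cf_convergent n a) < e"
    proof (intro exI[of _ N] allI impI)
      fix m n assume "N \<le> m" "m < n"
      then have "\<bar>cf_convergent m a - cf_convergent n a\<bar> \<le> 2 * (1 / 2) ^ m"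
        using assms by (intro cf_convergent_distance) auto
      also have "\<dots> \<le> 2 * (1 / 2) ^ N" using \<open>N \<le> m\<close> by (simp add: power_decreasing)
      finally show "dist (cf_convergent m a) (cf_convergent n a) < e" using N by (simp add: dist_real_def)
    qed
  qed
  then show ?thesis using that by (auto simp: Cauchy_convergent_iff convergent_def)
qed

lemma is_cf_expansion_step:
  assumes "is_cf_expansion a x"
  obtains y where "is_cf_expansion (\<lambda>k. a (Suc k)) y" "0 \<le> y" "x = 1 / (real (a 1) + y)"
proof -
  have a: "\<And>k. 1 \<le> k \<Longrightarrow> 1 \<le> a k" and lim: "(\<lambda>n. cf_convergent n a) \<longlonglongrightarrow> x"
    using assms by (auto simp: is_cf_expansion_def)
  have a': "\<And>k. 1 \<le> k \<Longrightarrow> 1 \<le> a (Suc k)" using a by simp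
  obtain y where y: "(\<lambda>n. cf_convergent n (\<lambda>k. a (Suc k))) \<longlonglongrightarrow> y"
    using cf_convergent_converges[of "\<lambda>k. a (Suc k)"] a' by blast
  have y0: "0 \<le> y"
    by (rule LIMSEQ_le_const[OF y]) (use cf_convergent_bounds[OF a'] in auto)
  have "(\<lambda>n. 1 / (real (a 1) + cf_convergent n (\<lambda>k. a (Suc k)))) \<longlonglongrightarrow> 1 / (real (a 1) + y)"
    using a[of 1] y0 by (intro tendsto_intros y) auto
  then have "(\<lambda>n. cf_convergent (Suc n) a) \<longlonglongrightarrow> 1 / (real (a 1) + y)" by simp
  then have "x = 1 / (real (a 1) + y)"
    using LIMSEQ_Suc[OF lim] LIMSEQ_unique by blast
  then show ?thesis using that y y0 a' by (auto simp: is_cf_expansion_def)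
qed

lemma is_cf_expansion_in_unit_interval:
  assumes "is_cf_expansion a x"
  shows "0 < x" "x < 1"
proof -
  have a: "1 \<le> a 1" "1 \<le> a 2" using assms by (auto simp: is_cf_expansion_def)
  obtain y where y: "is_cf_expansion (\<lambda>k. a (Suc k)) y" "0 \<le> y" "x = 1 / (real (a 1) + y)"
    using is_cf_expansion_step[OF assms] by blast
  obtain z where z: "0 \<le> z" "y = 1 / (real (a 2) + z)"
    using is_cf_expansion_step[OF y(1)] by (auto simp: numeral_2_eq_2)
  show "0 < x" using a y by simp
  have "0 < y" using a z by simp
  then show "x < 1" using a y by (simp add: divide_less_eq)
qed

text \<open>
  Infinite descent: for \<open>x = p / q\<close> in the open unit interval, the value of the shifted expansion is
  a fraction with the smaller denominator \<open>p\<close>.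
\<close>

lemma is_cf_expansion_not_fraction:
  "is_cf_expansion a x \<Longrightarrow> x \<noteq> real p / real q"
proof (induction q arbitrary: a x p rule: less_induct)
  case (less q)
  show ?case
  proof
    assume x: "x = real p / real q"
    note x01 = is_cf_expansion_in_unit_interval[OF less.prems]
    have pq: "0 < p" "p < q" using x x01 by (auto simp: zero_less_divide_iff divide_less_eq split: if_splits)
    obtain y where y: "is_cf_expansion (\<lambda>k. a (Suc k)) y" "x = 1 / (real (a 1) + y)"
      using is_cf_expansion_step[OF less.prems] by blast
    have y0: "0 < y" using is_cf_expansion_in_unit_interval[OF y(1)] by simp
    have "y = real q / real p - real (a 1)" using y(2) x y0 pq by (simp add: field_simps)
    then have eq: "y = (real q - real (a 1) * real p) / real p" using pq by (simp add: field_simps)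
    then have "real (a 1) * real p < real q" using y0 pq by (simp add: zero_less_divide_iff)
    then have "a 1 * p \<le> q" by (metis less_imp_le of_nat_le_iff of_nat_mult)
    then have "y = real (q - a 1 * p) / real p" using eq by simp
    then show False using less.IH[OF pq(2) y(1)] by blast
  qed
qed

lemma exists_with_cf_coeffs:
  assumes "\<And>k. 1 \<le> k \<Longrightarrow> 1 \<le> a k"
  obtains x where "x \<in> unit_irrationals" "\<And>k. 1 \<le> k \<Longrightarrow> cf_coeff k x = a k"
proof -
  obtain x where "(\<lambda>n. cf_convergent n a) \<longlonglongrightarrow> x"
    using cf_convergent_converges[of a] assms by blast
  then have x: "is_cf_expansion a x" using assms by (simp add: is_cf_expansion_def)
  have x01: "0 < x" "x < 1" by (rule is_cf_expansion_in_unit_interval[OF x])+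
  have "x \<notin> \<rat>"
  proof
    assume "x \<in> \<rat>"
    then obtain m n :: nat where "\<bar>x\<bar> = real m / real n" by (rule Rats_abs_nat_div_natE)
    then show False using is_cf_expansion_not_fraction[OF x, of m n] x01 by simp
  qed
  then have "x \<in> unit_irrationals" using x01 by (simp add: unit_irrationals_def)
  then show ?thesis using that is_cf_expansion_unique[OF _ x] by metis
qed

text \<open>
  Each common digit shrinks the distance by a factor \<open>x y \<ge> 1 / B\<^sup>2\<close>. At the first different digit, the
  reciprocals are at distance at least \<open>1 / 2\<close>: the digits differ by at least 1, and the tails are
  below \<open>1 / 2\<close> because all digits are at least 2. Without that bound, \<open>[a, 1, \<dots>]\<close> and \<open>[a + 1, \<dots>]\<close>
  could be arbitrarily close.
\<close>

lemma cf_separation: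
  assumes "x \<in> unit_irrationals" "y \<in> unit_irrationals"
    and "\<And>j. j < n \<Longrightarrow> cf_coeff (Suc j) x = cf_coeff (Suc j) y"
    and "cf_coeff (Suc n) x \<noteq> cf_coeff (Suc n) y"
    and "\<And>k. 1 \<le> k \<Longrightarrow> 2 \<le> cf_coeff k x" "\<And>k. 1 \<le> k \<Longrightarrow> 2 \<le> cf_coeff k y"
    and "\<And>j. j \<le> n \<Longrightarrow> real (cf_coeff (Suc j) x) + 1 \<le> B j"
    and "\<And>j. j \<le> n \<Longrightarrow> real (cf_coeff (Suc j) y) + 1 \<le> B j"
  shows "1 / (2 * (\<Prod>j\<le>n. (B j)\<^sup>2)) \<le> \<bar>x - y\<bar>"
  using assms
proof (induction n arbitrary: x y B)
  case (0 x y B)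
  define a b where "a = cf_coeff 1 x" and "b = cf_coeff 1 y"
  define x' y' where "x' = gauss_map x" and "y' = gauss_map y"
  note x' = gauss_map_in[OF 0(1)] and y' = gauss_map_in[OF 0(2)]
  have eq: "1 / x = real a + x'" "1 / y = real b + y'"
    using cf_coeff_1(2)[OF 0(1)] cf_coeff_1(2)[OF 0(2)] by (simp_all add: a_def b_def x'_def y'_def)
  have half: "0 < gauss_map u \<and> gauss_map u < 1 / 2"
    if u: "u \<in> unit_irrationals" and c: "\<And>k. 1 \<le> k \<Longrightarrow> 2 \<le> cf_coeff k u" for u
  proof -
    note v = gauss_map_in[OF u]
    note v01 = unit_irrationals_gt_0[OF v] and w01 = unit_irrationals_gt_0[OF gauss_map_in[OF v]]
    have "2 \<le> cf_coeff 1 (gauss_map u)" using c[of "Suc 1"] by (simp add: cf_coeff_Suc)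
    then have "2 < 1 / gauss_map u" using cf_coeff_1(2)[OF v] w01 by linarith
    then show ?thesis using v01 by (simp add: less_divide_eq divide_less_eq mult.commute)
  qed
  have x'b: "0 < x'" "x' < 1 / 2" and y'b: "0 < y'" "y' < 1 / 2"
    using half[OF 0(1,5)] half[OF 0(2,6)] by (auto simp: x'_def y'_def)
  have B: "real a + 1 \<le> B 0" "real b + 1 \<le> B 0" using 0(7,8)[of 0] by (simp_all add: a_def b_def)
  have "a \<noteq> b" using 0(4) by (simp add: a_def b_def)
  then have "1 \<le> \<bar>real a - real b\<bar>" by linarith
  then have gap: "1 / 2 \<le> \<bar>1 / y - 1 / x\<bar>" unfolding eq using x'b y'b by linarith
  have xy: "0 < x" "0 < y" using unit_irrationals_gt_0 0(1,2) by auto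
  have "1 / x \<le> B 0" "1 / y \<le> B 0" unfolding eq using B x'b y'b by linarith+
  then have B': "1 \<le> B 0 * x" "1 \<le> B 0 * y" using xy by (simp_all add: divide_le_eq mult.commute)
  have "1 * 1 \<le> (B 0 * x) * (B 0 * y)" using B' by (intro mult_mono) auto
  then have "1 \<le> (B 0)\<^sup>2 * (x * y)" by (simp add: power2_eq_square mult_ac)
  then have "1 / (B 0)\<^sup>2 \<le> x * y" using B by (simp add: divide_le_eq mult.commute)
  then have "1 / (B 0)\<^sup>2 * (1 / 2) \<le> x * y * \<bar>1 / y - 1 / x\<bar>"
    using gap xy by (intro mult_mono) auto
  also have "\<dots> = \<bar>x * y * (1 / y - 1 / x)\<bar>" using xy by (simp add: abs_mult)
  also have "x * y * (1 / y - 1 / x) = x - y" using xy by (simp add: field_simps)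
  finally show ?case by (simp add: mult.commute)
next
  case (Suc n x y B)
  define a where "a = cf_coeff 1 x"
  define x' y' where "x' = gauss_map x" and "y' = gauss_map y"
  have x': "x' \<in> unit_irrationals" and y': "y' \<in> unit_irrationals"
    using gauss_map_in Suc(2,3) by (auto simp: x'_def y'_def)
  have b_eq: "cf_coeff 1 y = a" using Suc(4)[of 0] by (simp add: a_def)
  have eq: "1 / x = real a + x'" "1 / y = real a + y'"
    using cf_coeff_1(2)[OF Suc(2)] cf_coeff_1(2)[OF Suc(3)] b_eq by (simp_all add: a_def x'_def y'_def)
  have sh: "cf_coeff (Suc j) x' = cf_coeff (Suc (Suc j)) x" "cf_coeff (Suc j) y' = cf_coeff (Suc (Suc j)) y" for j
    by (simp_all add: x'_def y'_def cf_coeff_Suc)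
  have sh': "2 \<le> cf_coeff k x'" "2 \<le> cf_coeff k y'" if "1 \<le> k" for k
    using Suc(6,7)[of "Suc k"] that by (simp_all add: x'_def y'_def cf_coeff_Suc)
  have IH: "1 / (2 * (\<Prod>j\<le>n. (B (Suc j))\<^sup>2)) \<le> \<bar>x' - y'\<bar>"
    by (rule Suc.IH) (use x' y' sh' Suc(4,5,8,9) in \<open>auto simp: sh\<close>)
  have B: "real a + 1 \<le> B 0" using Suc(8)[of 0] by (simp add: a_def)
  have xy: "0 < x" "0 < y" using unit_irrationals_gt_0 Suc(2,3) by auto
  have "x' < 1" "y' < 1" using unit_irrationals_gt_0 x' y' by auto
  then have "1 / x \<le> B 0" "1 / y \<le> B 0" unfolding eq using B by linarith+
  then have B': "1 \<le> B 0 * x" "1 \<le> B 0 * y" using xy by (simp_all add: divide_le_eq mult.commute)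
  have "1 * 1 \<le> (B 0 * x) * (B 0 * y)" using B' by (intro mult_mono) auto
  then have "1 \<le> (B 0)\<^sup>2 * (x * y)" by (simp add: power2_eq_square mult_ac)
  then have "1 / (B 0)\<^sup>2 \<le> x * y" using B by (simp add: divide_le_eq mult.commute)
  then have "1 / (B 0)\<^sup>2 * (1 / (2 * (\<Prod>j\<le>n. (B (Suc j))\<^sup>2))) \<le> x * y * \<bar>1 / y - 1 / x\<bar>"
    using IH xy unfolding eq by (intro mult_mono) (auto simp: abs_minus_commute intro!: prod_nonneg)
  also have "\<dots> = \<bar>x * y * (1 / y - 1 / x)\<bar>" using xy by (simp add: abs_mult)
  also have "x * y * (1 / y - 1 / x) = x - y" using xy by (simp add: field_simps)
  finally show ?case by (simp add: prod.atMost_Suc_shift mult_ac del: prod.atMost_Suc)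
qed

section \<open>Mixed radix expansions\<close>

text \<open>
  The expansion \<open>t = d\<^sub>0 / w\<^sub>0 + d\<^sub>1 / (w\<^sub>0 w\<^sub>1) + \<dots>\<close> with digits \<open>d\<^sub>n < w\<^sub>n\<close>, produced greedily: the
  tail is what is left of \<open>t\<close> after \<open>n\<close> digits, rescaled to \<open>[0, 1)\<close>.
\<close>

primrec radix_tail :: "(nat \<Rightarrow> nat) \<Rightarrow> nat \<Rightarrow> real \<Rightarrow> real" where
  "radix_tail w 0 t = t"
| "radix_tail w (Suc n) t = frac (real (w n) * radix_tail w n t)"

definition radix_digit :: "(nat \<Rightarrow> nat) \<Rightarrow> nat \<Rightarrow> real \<Rightarrow> nat" where
  "radix_digit w n t = nat \<lfloor>real (w n) * radix_tail w n t\<rfloor>"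

lemma radix_tail_in: "t \<in> {0..<1} \<Longrightarrow> radix_tail w n t \<in> {0..<1}"
  by (cases n) (auto simp: frac_lt_1)

lemma radix_digit_less:
  assumes "t \<in> {0..<1}" "0 < w n"
  shows "radix_digit w n t < w n"
proof -
  have "real (w n) * radix_tail w n t < real (w n)"
    using radix_tail_in[OF assms(1), of w n] assms(2) by simp
  then have "\<lfloor>real (w n) * radix_tail w n t\<rfloor> < int (w n)" by (simp add: floor_less_iff)
  then show ?thesis using assms(2) unfolding radix_digit_def by linarith
qed

lemma radix_common_prefix:
  assumes tu: "t \<in> {0..<1}" "u \<in> {0..<1}" and w: "\<And>j. 0 < w j"
    and "\<And>j. j < n \<Longrightarrow> radix_digit w j t = radix_digit w j u"
  shows "\<bar>t - u\<bar> * (\<Prod>j<n. real (w j)) = \<bar>radix_tail w n t - radix_tail w n u\<bar>"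
  using assms(4)
proof (induction n)
  case (Suc n)
  have fl: "real_of_int \<lfloor>real (w n) * radix_tail w n v\<rfloor> = real (radix_digit w n v)" if "v \<in> {0..<1}" for v
    using radix_tail_in[OF that, of w n] by (simp add: radix_digit_def)
  have "\<bar>t - u\<bar> * (\<Prod>j<Suc n. real (w j)) = real (w n) * \<bar>radix_tail w n t - radix_tail w n u\<bar>"
    using Suc by (simp add: mult_ac)
  also have "\<dots> = \<bar>real (w n) * radix_tail w n t - real (w n) * radix_tail w n u\<bar>"
    by (simp add: abs_mult flip: right_diff_distrib)
  also have "\<dots> = \<bar>radix_tail w (Suc n) t - radix_tail w (Suc n) u\<bar>"
    using Suc.prems[of n] by (simp add: frac_def fl[OF tu(1)] fl[OF tu(2)])
  finally show ?case .
qed simp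

lemma radix_common_prefix_le:
  assumes "t \<in> {0..<1}" "u \<in> {0..<1}" "\<And>j. 0 < w j"
    and "\<And>j. j < n \<Longrightarrow> radix_digit w j t = radix_digit w j u"
  shows "\<bar>t - u\<bar> * (\<Prod>j<n. real (w j)) \<le> 1"
proof -
  have "\<bar>t - u\<bar> * (\<Prod>j<n. real (w j)) = \<bar>radix_tail w n t - radix_tail w n u\<bar>"
    by (rule radix_common_prefix) (use assms in auto)
  moreover have "radix_tail w n t \<in> {0..<1}" "radix_tail w n u \<in> {0..<1}"
    using radix_tail_in assms(1,2) by auto
  ultimately show ?thesis by (simp add: abs_le_iff)
qed

section \<open>A Cantor set of prescribed digit sums\<close>

text \<open>
  From some index on, each factor \<open>v j\<close> is at least \<open>K\<close>, so the quotient of \<open>K ^ n\<close> by the product stops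
  increasing; \<open>C\<close> absorbs the finitely many quotients before.
\<close>

lemma exists_power_le_prod:
  fixes v :: "nat \<Rightarrow> real"
  assumes v: "\<And>j. 0 < v j" and K: "0 < K" and ev: "eventually (\<lambda>j. K \<le> v j) sequentially"
  obtains C where "0 < C" "\<And>n. K ^ n \<le> C * (\<Prod>j<n. v j)"
proof -
  obtain J where J: "\<And>j. J \<le> j \<Longrightarrow> K \<le> v j" using ev by (auto simp: eventually_sequentially)
  define r where "r n = K ^ n / (\<Prod>j<n. v j)" for n
  have P: "0 < (\<Prod>j<n. v j)" for n by (intro prod_pos) (use v in auto)
  have r_pos: "0 < r n" for n using P K by (simp add: r_def)
  have r_step: "r (Suc n) \<le> r n" if "J \<le> n" for n
  proof -
    have "r (Suc n) = r n * (K / v n)" by (simp add: r_def mult.commute)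
    also have "\<dots> \<le> r n * 1"
      using r_pos[of n] J[OF that] v[of n] by (intro mult_left_mono) (auto simp: divide_le_eq)
    finally show ?thesis by simp
  qed
  define C where "C = (\<Sum>i\<le>J. r i)"
  have r_le_C: "r i \<le> C" if "i \<le> J" for i
    unfolding C_def using that r_pos by (intro member_le_sum) (auto intro: less_imp_le)
  have "r n \<le> C" for n
  proof (cases "n \<le> J")
    case False
    then have "J \<le> n" by simp
    then have "r n \<le> r J"
      by (induction n rule: dec_induct) (auto intro: order_trans r_step)
    then show ?thesis using r_le_C[of J] by simp
  qed (rule r_le_C)
  then have "K ^ n \<le> C * (\<Prod>j<n. v j)" for n
    using P[of n] by (simp add: r_def divide_le_eq)
  moreover have "0 < C" using r_pos[of J] r_le_C[of J] by simp
  ultimately show ?thesis using that by blast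
qed

text \<open>
  The digit \<open>a\<^sub>j\<^sub>+\<^sub>1\<close> is \<open>p j + radix_digit w j t\<close>, where \<open>p j\<close> is about \<open>f (j + 1) - f j\<close> and the window
  has \<open>w j\<close>, that is, about \<open>f (j + 1)\<^bsup>\<theta>\<^esup>\<close> elements. The exponent \<open>\<theta> = s + 1 / 2\<close> lies strictly between \<open>2 s\<close> and 1: it
  must be below 1 for the windows to be negligible in the sum, and above \<open>2 s\<close> for the number of
  choices to exceed the cylinder sizes to the power \<open>s\<close>.
\<close>

lemma hausdorff_measure_cf_sum_set_neq_0:
  fixes f :: "nat \<Rightarrow> real"
  assumes s: "0 < s" "s < 1 / 2"
    and f0: "f 0 = 0" and f1: "\<And>n. 1 \<le> f (Suc n)" and mono: "mono f"
    and upper: "\<And>n. f (Suc n) \<le> D * A ^ n" and A: "0 < A"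
    and superpoly: "(\<lambda>n. real n * f n powr (s - 1 / 2)) \<longlonglongrightarrow> 0"
  shows "hausdorff_measure s {x \<in> unit_irrationals. (\<lambda>n. real (cf_sum n x) / f n) \<longlonglongrightarrow> 1} \<noteq> 0"
proof -
  let ?E = "{x \<in> unit_irrationals. (\<lambda>n. real (cf_sum n x) / f n) \<longlonglongrightarrow> 1}"
  define \<theta> where "\<theta> = s + 1 / 2"
  have \<theta>: "0 < \<theta>" "\<theta> < 1" using s by (auto simp: \<theta>_def)
  define w where "w j = nat \<lceil>f (Suc j) powr \<theta>\<rceil>" for j
  \<comment> \<open>The summand 2 makes all digits at least 2, which the separation of cylinders requires.\<close>
  define p where "p j = 2 + nat \<lceil>f (Suc j) - f j\<rceil>" for j
  define B where "B j = 6 * f (Suc j)" for j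
  have inc: "0 \<le> f (Suc j) - f j" for j using mono by (simp add: mono_def)
  have f_nonneg: "0 \<le> f j" for j using f1[of "j - 1"] f0 by (cases j) auto
  have powr_ge_1: "1 \<le> f (Suc j) powr \<theta>" for j using f1 \<theta> by (simp add: ge_one_powr_ge_zero)
  have w_lower: "f (Suc j) powr \<theta> \<le> real (w j)" and w_upper: "real (w j) < f (Suc j) powr \<theta> + 1" for j
    using powr_ge_1[of j] unfolding w_def by linarith+
  have w_pos: "0 < w j" for j using w_lower[of j] powr_ge_1[of j] by (cases "w j") auto
  have p_lower: "f (Suc j) - f j \<le> real (p j)" and p_upper: "real (p j) < f (Suc j) - f j + 3" for j
    using inc[of j] unfolding p_def by linarith+
  have B_ge: "6 \<le> B j" for j using f1[of j] by (simp add: B_def)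
  have B_nz: "B j \<noteq> 0" for j using B_ge[of j] by auto
  define a where "a t k = p (k - 1) + radix_digit w (k - 1) t" for t k
  have a_ge_2: "2 \<le> a t k" for t k by (simp add: a_def p_def)
  have "\<exists>x. x \<in> unit_irrationals \<and> (\<forall>k\<ge>1. cf_coeff k x = a t k)" for t
    using exists_with_cf_coeffs[of "a t"] a_ge_2 by (metis one_le_numeral order_trans)
  then obtain g where g: "\<And>t. g t \<in> unit_irrationals" and coeff: "\<And>t k. 1 \<le> k \<Longrightarrow> cf_coeff k (g t) = a t k"
    by metis
  have coeff_Suc: "cf_coeff (Suc j) (g t) = p j + radix_digit w j t" for t j
    by (simp add: coeff a_def)
  have digit: "real (radix_digit w j t) + 1 \<le> real (w j)" if "t \<in> {0..<1}" for t j
    using radix_digit_less[of t w j, OF that w_pos] by linarith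
  have B_upper: "real (cf_coeff (Suc j) (g t)) + 1 \<le> B j" if t: "t \<in> {0..<1}" for t j
  proof -
    have "f (Suc j) powr \<theta> \<le> f (Suc j) powr 1" using f1 \<theta> by (intro powr_mono) auto
    then have "f (Suc j) powr \<theta> \<le> f (Suc j)" using f1[of j] by simp
    then show ?thesis
      using digit[OF t, of j] w_upper[of j] p_upper[of j] f1[of j] f_nonneg[of j]
      by (simp add: coeff_Suc B_def)
  qed
  have mem: "g t \<in> ?E" if t: "t \<in> {0..<1}" for t
  proof -
    have sum_eq: "real (cf_sum n (g t)) = (\<Sum>j<n. real (p j + radix_digit w j t))" for n
      unfolding cf_sum_def by (simp add: sum.atLeast1_atMost_eq coeff_Suc)
    have lower: "f n \<le> real (cf_sum n (g t))" for n
    proof -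
      have "f n = (\<Sum>j<n. f (Suc j) - f j)" using f0 by (simp add: sum_lessThan_telescope)
      also have "\<dots> \<le> (\<Sum>j<n. real (p j + radix_digit w j t))"
        using p_lower by (intro sum_mono) (simp add: add_increasing2)
      finally show ?thesis by (simp add: sum_eq)
    qed
    have upper': "real (cf_sum n (g t)) \<le> f n + 4 * (real n * f n powr \<theta>)" for n
    proof -
      have "(\<Sum>j<n. real (p j + radix_digit w j t)) \<le> (\<Sum>j<n. (f (Suc j) - f j) + 4 * f n powr \<theta>)"
      proof (intro sum_mono)
        fix j assume "j \<in> {..<n}"
        then have "f (Suc j) \<le> f n" using mono by (simp add: mono_def)
        then have "f (Suc j) powr \<theta> \<le> f n powr \<theta>" using f1[of j] \<theta> by (intro powr_mono2) auto
        then show "real (p j + radix_digit w j t) \<le> (f (Suc j) - f j) + 4 * f n powr \<theta>"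
          using p_upper[of j] digit[OF t, of j] w_upper[of j] powr_ge_1[of j] by simp
      qed
      also have "\<dots> = f n + 4 * (real n * f n powr \<theta>)"
        using f0 by (simp add: sum.distrib sum_lessThan_telescope)
      finally show ?thesis by (simp add: sum_eq)
    qed
    have f_pos: "0 < f n" if "1 \<le> n" for n using f1[of "n - 1"] that by (cases n) auto
    have "(\<lambda>n. real (cf_sum n (g t)) / f n) \<longlonglongrightarrow> 1"
    proof (rule tendsto_sandwich)
      show "eventually (\<lambda>n. 1 \<le> real (cf_sum n (g t)) / f n) sequentially"
        using eventually_ge_at_top[of 1] by eventually_elim (use lower f_pos in \<open>simp add: le_divide_eq\<close>)
      show "eventually (\<lambda>n. real (cf_sum n (g t)) / f n \<le> 1 + 4 * (real n * f n powr (s - 1 / 2))) sequentially"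
        using eventually_ge_at_top[of 1]
      proof eventually_elim
        case (elim n)
        have "f n powr \<theta> = f n * f n powr (s - 1 / 2)"
          using f_pos[OF elim] by (simp add: \<theta>_def powr_mult_base add.commute)
        then show ?case
          using upper'[of n] f_pos[OF elim] by (simp add: divide_le_eq algebra_simps)
      qed
      show "(\<lambda>n. 1 + 4 * (real n * f n powr (s - 1 / 2))) \<longlonglongrightarrow> 1"
        using tendsto_add[OF tendsto_const tendsto_mult_right_zero[OF superpoly], of 1 4] by simp
    qed auto
    then show ?thesis using g by simp
  qed
  have D: "0 < D" using upper[of 0] f1[of 0] by simp
  \<comment> \<open>\<open>v j\<close> is what the digit \<open>j\<close> gains: the number of its choices over the \<open>s\<close>-th power of the factor by which it may shrink a cylinder.\<close>
  define v where "v j = real (w j) / B j powr (2 * s)" for j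
  have v_pos: "0 < v j" for j using w_pos[of j] B_ge[of j] by (simp add: v_def)
  define K where "K = A powr (2 * s)"
  have v_large: "eventually (\<lambda>j. K \<le> v j) sequentially"
  proof -
    define \<epsilon> where "\<epsilon> = 1 / (K * 6 powr (2 * s))"
    have \<epsilon>: "0 < \<epsilon>" using A by (simp add: \<epsilon>_def K_def)
    have "eventually (\<lambda>n. real n * f n powr (s - 1 / 2) < \<epsilon>) sequentially"
      by (rule order_tendstoD(2)[OF superpoly \<epsilon>])
    then have "eventually (\<lambda>j. real (Suc j) * f (Suc j) powr (s - 1 / 2) < \<epsilon>) sequentially"
      by (rule eventually_sequentially_Suc[THEN iffD2])
    then show ?thesis
    proof eventually_elim
      case (elim j)
      have "1 * f (Suc j) powr (s - 1 / 2) \<le> real (Suc j) * f (Suc j) powr (s - 1 / 2)"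
        by (intro mult_right_mono) auto
      then have "f (Suc j) powr (s - 1 / 2) \<le> \<epsilon>" using elim by simp
      then have "K * 6 powr (2 * s) * f (Suc j) powr (s - 1 / 2) \<le> 1"
        using A by (simp add: \<epsilon>_def K_def le_divide_eq mult_ac)
      then have "K * 6 powr (2 * s) * f (Suc j) powr (s - 1 / 2) * f (Suc j) powr \<theta> \<le> 1 * f (Suc j) powr \<theta>"
        by (intro mult_right_mono) auto
      also have "\<dots> \<le> real (w j)" using w_lower by simp
      also have "K * 6 powr (2 * s) * f (Suc j) powr (s - 1 / 2) * f (Suc j) powr \<theta> = K * B j powr (2 * s)"
        using f1[of j] by (simp add: B_def \<theta>_def powr_mult mult.assoc flip: powr_add)
      finally show ?case using B_ge[of j] by (simp add: v_def le_divide_eq)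
    qed
  qed
  have K0: "0 < K" using A by (simp add: K_def)
  obtain C where C: "0 < C" "\<And>n. K ^ n \<le> C * (\<Prod>j<n. v j)"
    using exists_power_le_prod[of v K] v_pos K0 v_large by blast
  define C' where "C' = (6 * D) powr (2 * s) * C"
  have C': "0 < C'" using C D by (simp add: C'_def)
  \<comment> \<open>The product on the left has one factor more than the one on the right; it is the price of the first different digit, and the accumulated gains pay for it.\<close>
  have key: "(\<Prod>j\<le>n. B j powr (2 * s)) \<le> C' * (\<Prod>j<n. real (w j))" for n
  proof -
    have "B n powr (2 * s) \<le> (6 * D * A ^ n) powr (2 * s)"
      using upper[of n] f1[of n] s by (intro powr_mono2) (auto simp: B_def)
    also have "\<dots> = (6 * D) powr (2 * s) * K ^ n"
      using A D by (simp add: powr_mult K_def powr_powr powr_power mult_ac flip: powr_realpow)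
    also have "\<dots> \<le> (6 * D) powr (2 * s) * (C * (\<Prod>j<n. v j))"
      by (intro mult_left_mono C) auto
    also have "\<dots> = C' * (\<Prod>j<n. v j)" by (simp add: C'_def)
    finally have "(\<Prod>j<n. B j powr (2 * s)) * B n powr (2 * s) \<le> (\<Prod>j<n. B j powr (2 * s)) * (C' * (\<Prod>j<n. v j))"
      by (intro mult_left_mono prod_nonneg) auto
    also have "\<dots> = C' * (\<Prod>j<n. B j powr (2 * s) * v j)" by (simp add: prod.distrib)
    also have "(\<Prod>j<n. B j powr (2 * s) * v j) = (\<Prod>j<n. real (w j))"
    proof (rule prod.cong)
      fix j show "B j powr (2 * s) * v j = real (w j)" using B_ge[of j] by (simp add: v_def)
    qed simp
    finally show ?thesis by (simp flip: lessThan_Suc_atMost)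
  qed
  have W: "0 < (\<Prod>j<n. real (w j))" for n by (intro prod_pos) (use w_pos in auto)
  show ?thesis
  proof (rule hausdorff_measure_nonzero_if_inverse_hoelder[of s "C' * 2 powr s" g])
    fix t u :: real assume t: "t \<in> {0..<1}" and u: "u \<in> {0..<1}"
    have prefix: "\<bar>t - u\<bar> \<le> C' / (\<Prod>j\<le>n. B j powr (2 * s))"
      if "\<And>j. j < n \<Longrightarrow> radix_digit w j t = radix_digit w j u" for n
    proof -
      have P: "0 < (\<Prod>j\<le>n. B j powr (2 * s))" by (intro prod_pos) (simp add: B_nz)
      have "\<bar>t - u\<bar> * (\<Prod>j<n. real (w j)) \<le> 1"
        by (rule radix_common_prefix_le[OF t u w_pos that])
      then have "\<bar>t - u\<bar> \<le> 1 / (\<Prod>j<n. real (w j))" using W by (simp add: le_divide_eq)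
      also have "\<dots> \<le> C' / (\<Prod>j\<le>n. B j powr (2 * s))"
        using key[of n] W P by (simp add: divide_simps mult.commute)
      finally show ?thesis .
    qed
    show "\<bar>t - u\<bar> \<le> C' * 2 powr s * dist (g t) (g u) powr s"
    proof (cases "\<forall>j. radix_digit w j t = radix_digit w j u")
      case True
      \<comment> \<open>Then \<open>t\<close> and \<open>u\<close> coincide: they share prefixes of every length.\<close>
      have bound: "\<bar>t - u\<bar> \<le> C' / (6 powr (2 * s)) ^ n" for n
      proof -
        have "(6 powr (2 * s)) ^ n \<le> (6 powr (2 * s)) ^ Suc n"
          using s by (intro power_increasing) (auto simp: ge_one_powr_ge_zero)
        also have "\<dots> = (\<Prod>j\<le>n. 6 powr (2 * s))" by simp
        also have "\<dots> \<le> (\<Prod>j\<le>n. B j powr (2 * s))"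
          using B_ge s by (intro prod_mono conjI powr_mono2) auto
        finally have "C' / (\<Prod>j\<le>n. B j powr (2 * s)) \<le> C' / (6 powr (2 * s)) ^ n"
          using C' by (intro divide_left_mono) (auto intro!: mult_pos_pos prod_pos simp: B_nz)
        then show ?thesis using prefix[of n] True by simp
      qed
      have lim: "(\<lambda>n. C' / (6 powr (2 * s)) ^ n) \<longlonglongrightarrow> 0"
        using s by (intro LIMSEQ_divide_realpow_zero) (simp add: gr_one_powr)
      have "\<bar>t - u\<bar> \<le> 0" by (rule LIMSEQ_le_const[OF lim]) (use bound in blast)
      then show ?thesis using C' by simp
    next
      case False
      define n where "n = (LEAST j. radix_digit w j t \<noteq> radix_digit w j u)"
      have n: "radix_digit w n t \<noteq> radix_digit w n u"
        unfolding n_def by (rule LeastI_ex) (use False in blast)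
      have before: "radix_digit w j t = radix_digit w j u" if "j < n" for j
        using not_less_Least[OF that[unfolded n_def]] by simp
      define P where "P = (\<Prod>j\<le>n. (B j)\<^sup>2)"
      have P: "0 < P" unfolding P_def by (intro prod_pos) (simp add: B_nz)
      have sep: "1 / (2 * P) \<le> \<bar>g t - g u\<bar>"
        unfolding P_def
        by (rule cf_separation) (use g before n coeff a_ge_2 B_upper t u in \<open>auto simp: coeff_Suc\<close>)
      have "(\<Prod>j\<le>n. B j powr (2 * s)) = P powr s"
      proof -
        have "P powr s = (\<Prod>j\<le>n. (B j)\<^sup>2 powr s)"
          unfolding P_def by (rule prod_powr_distrib)
        also have "\<dots> = (\<Prod>j\<le>n. B j powr (2 * s))"
        proof (rule prod.cong)
          fix j
          have "0 < B j" using B_ge[of j] by simp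
          then show "(B j)\<^sup>2 powr s = B j powr (2 * s)" by (simp add: powr_powr flip: powr_numeral)
        qed simp
        finally show ?thesis by simp
      qed
      then have "\<bar>t - u\<bar> \<le> C' / P powr s" using prefix[of n] before by simp
      also have "\<dots> = C' * 2 powr s * (1 / (2 * P)) powr s"
        using P by (simp add: powr_divide powr_mult)
      also have "\<dots> \<le> C' * 2 powr s * \<bar>g t - g u\<bar> powr s"
        using sep s P C' by (intro mult_left_mono powr_mono2) auto
      finally show ?thesis by (simp add: dist_real_def)
    qed
  qed (use s C' mem in auto)
qed

section \<open>The dimension of the set\<close>

theorem corollary1p3:
  fixes c :: real and r1 :: "real \<Rightarrow> real"
  assumes "0 < c"
    and "\<And>t. 0 < t \<Longrightarrow> 0 < r1 t"
    and "mono_on {0<..} r1"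
    and "(\<lambda>n. r1 (real n) / sqrt (real n)) \<longlonglongrightarrow> 0"
  shows "hausdorff_dim (cf_sum_set (\<lambda>t. exp (c * sqrt t + r1 t))) = ereal (1 / 2)"
proof (rule hausdorff_dim_eqI)
  let ?\<phi> = "\<lambda>t. exp (c * sqrt t + r1 t)"
  have r1_mono: "r1 (real m) \<le> r1 (real n)" if "1 \<le> m" "m \<le> n" for m n
    using assms(3) that by (intro mono_onD[of "{0<..}" r1]) auto
  show "(0 :: real) < 1 / 2" by simp
  show "hausdorff_measure s (cf_sum_set ?\<phi>) = 0" if "1 / 2 < s" for s
    unfolding cf_sum_set_def
  proof (rule hausdorff_measure_cf_sum_set_eq_0[OF assms(1) that, where \<phi> = "\<lambda>n. ?\<phi> (real n)"])
    fix m n :: nat assume mn: "1 \<le> m" "m \<le> n"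
    show "?\<phi> (real m) * exp (c * (sqrt (real n) - sqrt (real m))) \<le> ?\<phi> (real n)"
      using r1_mono[OF mn] by (simp add: algebra_simps flip: exp_add)
  next
    fix n :: nat assume "1 \<le> n"
    then show "exp (c * sqrt (real n)) \<le> ?\<phi> (real n)" using assms(2)[of "real n"] by simp
  qed
  show "hausdorff_measure s (cf_sum_set ?\<phi>) \<noteq> 0" if s: "0 < s" "s < 1 / 2" for s
  proof -
    \<comment> \<open>The value of \<open>r1\<close> at 0 is arbitrary, so the sequence is restarted with 0 there.\<close>
    define f where "f n = (if n = 0 then 0 else ?\<phi> (real n))" for n :: nat
    have "Bseq (\<lambda>n. r1 (real n) / sqrt (real n))"
      by (rule convergent_imp_Bseq) (use assms(4) in \<open>auto simp: convergent_def\<close>)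
    then obtain R where R: "0 < R" "\<And>n. \<bar>r1 (real n) / sqrt (real n)\<bar> \<le> R"
      by (auto simp: Bseq_def)
    have "hausdorff_measure s {x \<in> unit_irrationals. (\<lambda>n. real (cf_sum n x) / f n) \<longlonglongrightarrow> 1} \<noteq> 0"
    proof (rule hausdorff_measure_cf_sum_set_neq_0[OF s, where A = "exp (c + R)" and D = "exp (c + R)"])
      show "f 0 = 0" by (simp add: f_def)
      show "1 \<le> f (Suc n)" for n
        using assms(1) assms(2)[of "real (Suc n)"] by (simp add: f_def)
      show "mono f"
      proof (rule monoI)
        fix m n :: nat assume "m \<le> n"
        then show "f m \<le> f n"
          using r1_mono[of m n] assms(1) by (auto simp: f_def intro!: add_mono mult_left_mono)
      qed
      show "f (Suc n) \<le> exp (c + R) * exp (c + R) ^ n" for n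
      proof -
        have sq: "1 \<le> sqrt (real (Suc n))" "sqrt (real (Suc n)) \<le> real (Suc n)"
          by (auto intro!: real_le_lsqrt simp: power2_eq_square)
        have "r1 (real (Suc n)) / sqrt (real (Suc n)) \<le> R" using R(2)[of "Suc n"] by linarith
        then have "r1 (real (Suc n)) \<le> R * sqrt (real (Suc n))" using sq by (simp add: divide_le_eq)
        then have "c * sqrt (real (Suc n)) + r1 (real (Suc n)) \<le> (c + R) * sqrt (real (Suc n))"
          by (simp add: algebra_simps)
        also have "\<dots> \<le> (c + R) * real (Suc n)" using sq R(1) assms(1) by (intro mult_left_mono) auto
        finally have "f (Suc n) \<le> exp ((c + R) * real (Suc n))" by (simp add: f_def)
        also have "\<dots> = exp (c + R) ^ Suc n" by (simp only: exp_of_nat2_mult)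
        finally show ?thesis by simp
      qed
      show "(\<lambda>n. real n * f n powr (s - 1 / 2)) \<longlonglongrightarrow> 0"
      proof -
        define b where "b = c * (1 / 2 - s)"
        have b: "0 < b" using assms(1) s by (simp add: b_def)
        show ?thesis
        proof (rule tendsto_sandwich[where f = "\<lambda>_. 0"])
          show "(\<lambda>n::nat. real n * exp (- b * sqrt (real n))) \<longlonglongrightarrow> 0" using b by real_asymp
          show "eventually (\<lambda>n. real n * f n powr (s - 1 / 2) \<le> real n * exp (- b * sqrt (real n))) sequentially"
            using eventually_ge_at_top[of 1]
          proof eventually_elim
            case (elim n)
            have "f n powr (s - 1 / 2) \<le> exp (c * sqrt (real n)) powr (s - 1 / 2)"
              using s elim assms(2)[of "real n"] by (intro powr_mono2') (auto simp: f_def)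
            also have "\<dots> = exp (- b * sqrt (real n))" by (simp add: powr_def b_def algebra_simps)
            finally show ?case by (intro mult_left_mono) auto
          qed
        qed auto
      qed
    qed simp
    moreover have "((\<lambda>n. real (cf_sum n x) / f n) \<longlonglongrightarrow> 1) \<longleftrightarrow> ((\<lambda>n. real (cf_sum n x) / ?\<phi> (real n)) \<longlonglongrightarrow> 1)" for x
      by (rule filterlim_cong) (auto simp: f_def eventually_sequentially intro!: exI[of _ 1])
    ultimately show ?thesis by (simp add: cf_sum_set_def)
  qed
qed

end
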